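(* Let $X_{ij}$ be i.i.d. real random variables with finite moments $m_r=\mathbb{E}X_{ij}^r$, $r\le4$. For $0\le p\le n$ let $U=(X_{ij})_{n\times p}$, $f_4(n,p)=\mathbb{E}\,|U^TU|^2$, and $$F_4(t,\omega)=\sum_{n=0}^\infty\sum_{p=0}^n\frac{(n-p)!}{n!\,p!}\,t^p\omega^{n-p}f_4(n,p).$$ Put $\mu_2=m_2-m_1^2$, $\mu_3=m_3-3m_1m_2+2m_1^3$, $\mu_4=m_4-4m_1m_3+6m_1^2m_2-3m_1^4$. Then, as an identity of power series in $t,\omega$, $$F_4(t,\omega)=\frac{e^{t(\mu_4-3\mu_2^2)}}{(1-\mu_2^2t)^4(1-\omega-\mu_2^2t)}\left(1+\sum_{k=1}^6p_kt^k+\frac{\omega m_1^2}{1-\omega-\mu_2^2t}\sum_{k=1}^4\tilde p_kt^k+\frac{2\omega^2m_1^4\mu_2^2t^2}{(1-\omega-\mu_2^2t)^2}\right),$$ where $$\begin{aligned} p_1&=m_1^4+6m_1^2\mu_2-2\mu_2^2+4m_1\mu_3,\\ p_2&=7m_1^4\mu_2^2-6m_1^2\mu_2^3+\mu_2^4+12m_1^3\mu_2\mu_3-8m_1\mu_2^2\mu_3+6m_1^2\mu_3^2,\\ p_3&=2m_1\left(2m_1^3\mu_2^4-6m_1^2\mu_2^3\mu_3+2\mu_2^4\mu_3+3m_1^3\mu_2\mu_3^2-6m_1\mu_2^2\mu_3^2+2m_1^2\mu_3^3\right),\\ p_4&=m_1^2\mu_3^2\left(m_1^2\mu_3^2-6m_1^2\mu_2^3+6\mu_2^4-8m_1\mu_2^2\mu_3\right),\\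 p_5&=2m_1^3\mu_2^2\mu_3^3\left(2\mu_2^2-m_1\mu_3\right),\qquad p_6=m_1^4\mu_2^4\mu_3^4,\\ \tilde p_1&=m_1^2+2\mu_2,\qquad \tilde p_2=5m_1^2\mu_2^2+4m_1\mu_2\mu_3-2\mu_2^3,\\ \tilde p_3&=2m_1^2\mu_2^4-4m_1\mu_2^3\mu_3+2m_1^2\mu_2\mu_3^2,\qquad \tilde p_4=-2m_1^2\mu_2^3\mu_3^2 . \end{aligned}$$
   Context: $|M|$ denotes the determinant of a square matrix $M$. By definition $|U^TU|=1$ when $p=0$, so $f_4(n,0)=1$. *)

theory Defs
  imports
    "HOL-Probability.Probability"
    "HOL-Computational_Algebra.Formal_Power_Series"
    "Jordan_Normal_Form.Determinant"
begin

definition random_mat :: "(nat \<Rightarrow> nat \<Rightarrow> 'a \<Rightarrow> real) \<Rightarrow> nat \<Rightarrow> nat \<Rightarrow> 'a \<Rightarrow> real mat" where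
  "random_mat X n p x = mat n p (\<lambda>(i, j). X i j x)"

text \<open>The determinant of a \<open>0 \<times> 0\<close> matrix is 1 (\<open>det_dim_zero\<close>), so \<open>f4 M X n 0 = 1\<close> when \<open>M\<close> is a
  probability space.\<close>
definition f4 :: "'a measure \<Rightarrow> (nat \<Rightarrow> nat \<Rightarrow> 'a \<Rightarrow> real) \<Rightarrow> nat \<Rightarrow> nat \<Rightarrow> real" where
  "f4 M X n p =
     (\<integral>x. (Determinant.det (transpose_mat (random_mat X n p x) * random_mat X n p x)) ^ 2 \<partial>M)"

text \<open>Power series in \<open>t\<close> and \<open>\<omega>\<close> are elements of \<open>\<real>[[t]][[\<omega>]]\<close>: the coefficient of \<open>t ^ p * \<omega> ^ q\<close>
  in \<open>A\<close> is \<open>fps_nth (fps_nth A q) p\<close>.\<close>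
type_synonym bifps = "real fps fps"

definition bi_t :: bifps where
  "bi_t = fps_const fps_X"

definition bi_omega :: bifps where
  "bi_omega = fps_X"

definition bi_const :: "real \<Rightarrow> bifps" where
  "bi_const c = fps_const (fps_const c)"

text \<open>Division in \<open>\<real>[[t]][[\<omega>]]\<close> is exact for denominators with nonzero constant term, although the
  coefficient ring \<open>\<real>[[t]]\<close> is not a field.\<close>
lemma bi_divide_mult_cancel:
  fixes f g :: bifps
  assumes "fps_nth (fps_nth g 0) 0 \<noteq> 0"
  shows "f / g * g = f"
proof -
  have "fps_nth g 0 \<noteq> 0"
    using assms by auto
  then have "subdegree g = 0"
    by (simp add: subdegree_eq_0_iff)
  moreover have "inverse g * g = 1"
    using fps_left_inverse'[OF inverse_mult_eq_1[OF assms] inverse_mult_eq_1'[OF assms]]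
    by (simp only: fps_inverse_def[of g])
  ultimately show ?thesis
    by (simp add: fps_divide_def mult.assoc)
qed

text \<open>\<open>bi_exp_t c\<close> is the series \<open>exp (c t)\<close>.\<close>
definition bi_exp_t :: "real \<Rightarrow> bifps" where
  "bi_exp_t c = fps_const (fps_exp c)"

text \<open>The monomials \<open>t ^ p * \<omega> ^ (n - p)\<close> with \<open>p \<le> n\<close> are pairwise distinct, so the double sum defining
  \<open>F4\<close> is given by its coefficients; \<open>t ^ p * \<omega> ^ q\<close> comes from \<open>n = p + q\<close> only.\<close>
definition F4 :: "'a measure \<Rightarrow> (nat \<Rightarrow> nat \<Rightarrow> 'a \<Rightarrow> real) \<Rightarrow> bifps" where
  "F4 M X = Abs_fps (\<lambda>q. Abs_fps (\<lambda>p. let n = p + q in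
     fact (n - p) / (fact n * fact p) * f4 M X n p))"

text \<open>In the next two definitions \<open>a\<close>, \<open>b\<close>, \<open>c\<close> stand for \<open>m\<^sub>1\<close>, \<open>\<mu>\<^sub>2\<close>, \<open>\<mu>\<^sub>3\<close>.\<close>

definition p_coeff :: "real \<Rightarrow> real \<Rightarrow> real \<Rightarrow> nat \<Rightarrow> real" where
  "p_coeff a b c k =
    (if k = 1 then a^4 + 6 * a^2 * b - 2 * b^2 + 4 * a * c
     else if k = 2 then
       7 * a^4 * b^2 - 6 * a^2 * b^3 + b^4 + 12 * a^3 * b * c - 8 * a * b^2 * c + 6 * a^2 * c^2
     else if k = 3 then
       2 * a * (2 * a^3 * b^4 - 6 * a^2 * b^3 * c + 2 * b^4 * c + 3 * a^3 * b * c^2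
                - 6 * a * b^2 * c^2 + 2 * a^2 * c^3)
     else if k = 4 then
       a^2 * c^2 * (a^2 * c^2 - 6 * a^2 * b^3 + 6 * b^4 - 8 * a * b^2 * c)
     else if k = 5 then 2 * a^3 * b^2 * c^3 * (2 * b^2 - a * c)
     else if k = 6 then a^4 * b^4 * c^4
     else 0)"

definition pt_coeff :: "real \<Rightarrow> real \<Rightarrow> real \<Rightarrow> nat \<Rightarrow> real" where
  "pt_coeff a b c k =
    (if k = 1 then a^2 + 2 * b
     else if k = 2 then 5 * a^2 * b^2 + 4 * a * b * c - 2 * b^3
     else if k = 3 then 2 * a^2 * b^4 - 4 * a * b^3 * c + 2 * a^2 * b * c^2
     else if k = 4 then - 2 * a^2 * b^3 * c^2
     else 0)"

end

theory Submission
  imports Defs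
begin

text \<open>
  Let \<open>g(v\<^sub>1, \<dots>, v\<^sub>p)\<close> be the Gram determinant of the columns of \<open>U\<close> and \<open>e\<close> the all-ones vector.
  Expanding in one random column \<open>x\<close>, \<open>g\<close> is a quadratic form \<open>x\<^sup>T Q x\<close>, where \<open>Q\<close> depends on the other
  columns \<open>W\<close>, vanishes on their span, and satisfies \<open>Q\<^sup>2 = g(W) Q\<close> and \<open>tr Q = (n - p) g(W)\<close>; its
  diagonal entry \<open>Q\<^sub>i\<^sub>i\<close> is the Gram determinant of \<open>W\<close> with row \<open>i\<close> deleted.  Averaging \<open>(x\<^sup>T Q x)\<^sup>2\<close>
  over \<open>x\<close> therefore leads to a closed system of linear recurrences in \<open>n\<close> and \<open>p\<close> for five
  expectations: \<open>A = E g(W)\<^sup>2\<close>, \<open>B = E g(W) g(e, W)\<close>, \<open>C = E g(e, W)\<^sup>2\<close>,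
  \<open>D = E \<Sum>\<^sub>i (Q e)\<^sub>i Q\<^sub>i\<^sub>i\<close> and \<open>H = E \<Sum>\<^sub>i (Q e)\<^sub>i R\<^sub>i\<^sub>i\<close>, where \<open>R\<close> is the quadratic form belonging to
  \<open>(e, W)\<close>.  The last two are reduced to the others by averaging over row \<open>i\<close>, in which \<open>(Q e)\<^sub>i\<close> is
  affine.  After normalisation the recurrences become differential equations in \<open>t\<close> for the
  coefficients of the \<open>\<omega>\<^sup>q\<close>, with solutions of the form \<open>exp (\<kappa>t) (1 - \<mu>\<^sub>2\<^sup>2 t)\<^sup>-\<^sup>q\<^sup>-\<^sup>5\<close> times a polynomial
  in \<open>q\<close> and \<open>t\<close>.
\<close>

section \<open>Determinants over finite index sets\<close>

text \<open>Arbitrary finite index sets allow columns to be adjoined and removed without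
  renumbering; \<open>f4_EA\<close> makes the link to the matrix determinant.\<close>

definition set_det :: "'i set \<Rightarrow> ('i \<Rightarrow> 'i \<Rightarrow> real) \<Rightarrow> real" where
  "set_det J A = (\<Sum>p | p permutes J. of_int (sign p) * (\<Prod>i\<in>J. A i (p i)))"

lemma set_det_cong: "(\<And>i j. i \<in> J \<Longrightarrow> j \<in> J \<Longrightarrow> A i j = B i j) \<Longrightarrow> set_det J A = set_det J B"
  unfolding set_det_def by (intro sum.cong refl arg_cong2[where f="(*)"] prod.cong) (auto simp: permutes_in_image)

lemma set_det_empty [simp]: "set_det {} A = 1"
  by (simp add: set_det_def)

lemma set_det_transpose: "finite J \<Longrightarrow> set_det J (\<lambda>i j. A j i) = set_det J A"
  unfolding set_det_def
  by (subst sum_permutations_inverse, intro sum.cong refl)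
     (auto simp: sign_inverse permutation_permutes permutes_inv_eq
           intro!: arg_cong2[where f="(*)"] sign_inverse prod.permutes_inv
           dest: permutes_imp_permutation prod.permutes_inv[symmetric])

text \<open>Every permutation of \<open>insert a J\<close> is uniquely \<open>transpose a b\<close>
  after a permutation of \<open>J\<close>, with \<open>b\<close> the image of \<open>a\<close>. For
  \<open>b\<close> in \<open>J\<close> the transposition contributes the minus sign and sends to
  \<open>a\<close> the row that would have used column \<open>b\<close>.\<close>

lemma set_det_insert:
  assumes J: "finite J" and a: "a \<notin> J"
  shows "set_det (insert a J) A =
    A a a * set_det J A - (\<Sum>b\<in>J. A a b * set_det J (\<lambda>i j. A i (if j = b then a else j)))"
proof -
  have summand: "(\<Sum>q | q permutes J. of_int (sign (Transposition.transpose a b \<circ> q)) *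
        (\<Prod>i\<in>insert a J. A i ((Transposition.transpose a b \<circ> q) i)))
      = (if b = a then A a a * set_det J A else - (A a b * set_det J (\<lambda>i j. A i (if j = b then a else j))))"
    if b: "b \<in> insert a J" for b
  proof -
    have "of_int (sign (Transposition.transpose a b \<circ> q)) * (\<Prod>i\<in>insert a J. A i ((Transposition.transpose a b \<circ> q) i))
       = (if b = a then 1 else - 1) * A a b *
         (of_int (sign q) * (\<Prod>i\<in>J. A i (if q i = b then a else q i)))" if q: "q permutes J" for q
    proof -
      have "q a = a" using q a by (simp add: permutes_not_in)
      moreover have "Transposition.transpose a b (q i) = (if q i = b then a else q i)" if "i \<in> J" for i
        using that q a by (auto simp: Transposition.transpose_def permutes_in_image)
      moreover have "sign (Transposition.transpose a b \<circ> q) = (if b = a then 1 else - 1) * sign q"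
        using q J by (auto simp: sign_compose permutation_swap_id permutes_imp_permutation sign_swap_id)
      ultimately show ?thesis using J a by (simp add: algebra_simps)
    qed
    then have "(\<Sum>q | q permutes J. of_int (sign (Transposition.transpose a b \<circ> q)) *
        (\<Prod>i\<in>insert a J. A i ((Transposition.transpose a b \<circ> q) i)))
      = (if b = a then 1 else - 1) * A a b * set_det J (\<lambda>i j. A i (if j = b then a else j))"
      unfolding set_det_def sum_distrib_left by (intro sum.cong) auto
    also have "\<dots> = (if b = a then A a a * set_det J A
        else - (A a b * set_det J (\<lambda>i j. A i (if j = b then a else j))))"
      by (auto intro!: set_det_cong)
    finally show ?thesis .
  qed
  have "set_det (insert a J) A = (\<Sum>b\<in>insert a J.
      if b = a then A a a * set_det J A else - (A a b * set_det J (\<lambda>i j. A i (if j = b then a else j))))"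
    unfolding set_det_def[of "insert a J"]
    by (subst sum_over_permutations_insert[OF J a]) (intro sum.cong refl summand)
  also have "\<dots> = A a a * set_det J A + (\<Sum>b\<in>J. - (A a b * set_det J (\<lambda>i j. A i (if j = b then a else j))))"
    using J a by (subst sum.insert) (auto intro!: sum.cong)
  finally show ?thesis by (simp add: sum_negf)
qed

text \<open>Composition with the transposition of \<open>a\<close> and \<open>b\<close> keeps each
  product and flips each sign, so the determinant equals its negative.\<close>

lemma set_det_identical_rows:
  assumes J: "finite J" and ab: "a \<in> J" "b \<in> J" "a \<noteq> b" and eq: "A a = A b"
  shows "set_det J A = 0"
proof -
  let ?t = "Transposition.transpose a b"
  have t: "?t permutes J" using ab by (simp add: permutes_swap_id)
  have "set_det J A = (\<Sum>p | p permutes J. of_int (sign (p \<circ> ?t)) * (\<Prod>i\<in>J. A i ((p \<circ> ?t) i)))"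
    unfolding set_det_def by (rule sum_permutations_compose_right[OF t])
  also have "\<dots> = (\<Sum>p | p permutes J. - (of_int (sign p) * (\<Prod>i\<in>J. A i (p i))))"
  proof (intro sum.cong refl)
    fix p assume "p \<in> {p. p permutes J}"
    then have p: "p permutes J" by simp
    have "(\<Prod>i\<in>J. A i (p i)) = (\<Prod>i\<in>J. A (?t i) (p (?t i)))"
      using prod.permute[OF t, of "\<lambda>i. A i (p i)"] by (simp add: o_def)
    also have "\<dots> = (\<Prod>i\<in>J. A i (p (?t i)))"
      using eq by (intro prod.cong refl) (auto simp: Transposition.transpose_def)
    finally have "(\<Prod>i\<in>J. A i (p i)) = (\<Prod>i\<in>J. A i ((p \<circ> ?t) i))" by simp
    moreover have "sign (p \<circ> ?t) = - sign p"
      using p J ab by (simp add: sign_compose permutation_swap_id permutes_imp_permutation sign_swap_id)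
    ultimately show "of_int (sign (p \<circ> ?t)) * (\<Prod>i\<in>J. A i ((p \<circ> ?t) i)) = - (of_int (sign p) * (\<Prod>i\<in>J. A i (p i)))"
      by simp
  qed
  also have "\<dots> = - set_det J A" by (simp add: set_det_def sum_negf)
  finally show ?thesis by simp
qed

section \<open>Gram determinants\<close>

definition inner_on :: "'r set \<Rightarrow> ('r \<Rightarrow> real) \<Rightarrow> ('r \<Rightarrow> real) \<Rightarrow> real" where
  "inner_on K x y = (\<Sum>k\<in>K. x k * y k)"

text \<open>Two families are allowed because the expansions below replace vectors on one side only;
  the Gram determinant proper is the case \<open>f = g\<close>.\<close>

definition gram :: "'r set \<Rightarrow> 'i set \<Rightarrow> ('i \<Rightarrow> 'r \<Rightarrow> real) \<Rightarrow> ('i \<Rightarrow> 'r \<Rightarrow> real) \<Rightarrow> real" where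
  "gram K J f g = set_det J (\<lambda>i j. inner_on K (f i) (g j))"

definition std_basis :: "'r \<Rightarrow> 'r \<Rightarrow> real" where
  "std_basis k = (\<lambda>l. if l = k then 1 else 0)"

lemma inner_on_sym: "inner_on K x y = inner_on K y x"
  by (simp add: inner_on_def mult.commute)

lemma inner_on_sum_left: "inner_on K (\<lambda>k. \<Sum>i\<in>I. c i * h i k) y = (\<Sum>i\<in>I. c i * inner_on K (h i) y)"
  unfolding inner_on_def sum_distrib_left sum_distrib_right
  by (subst sum.swap) (simp add: mult.assoc)

lemma inner_on_std_basis_right: "finite K \<Longrightarrow> k \<in> K \<Longrightarrow> inner_on K x (std_basis k) = x k"
  by (simp add: inner_on_def std_basis_def if_distrib cong: if_cong)

lemma inner_on_std_basis_left: "finite K \<Longrightarrow> k \<in> K \<Longrightarrow> inner_on K (std_basis k) x = x k"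
  by (simp add: inner_on_sym[of K _ x] inner_on_std_basis_right)

lemma inner_on_cong: "(\<And>k. k \<in> K \<Longrightarrow> x k = x' k) \<Longrightarrow> (\<And>k. k \<in> K \<Longrightarrow> y k = y' k) \<Longrightarrow> inner_on K x y = inner_on K x' y'"
  by (simp add: inner_on_def)

lemma gram_cong:
  assumes "\<And>i k. i \<in> J \<Longrightarrow> k \<in> K \<Longrightarrow> f i k = f' i k" "\<And>i k. i \<in> J \<Longrightarrow> k \<in> K \<Longrightarrow> g i k = g' i k"
  shows "gram K J f g = gram K J f' g'"
  unfolding gram_def by (intro set_det_cong inner_on_cong assms)

lemma gram_sym: "finite J \<Longrightarrow> gram K J f g = gram K J g f"
  unfolding gram_def by (subst set_det_transpose[symmetric]) (simp_all add: inner_on_sym)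

lemma gram_insert:
  assumes "finite J" "a \<notin> J"
  shows "gram K (insert a J) f g =
    inner_on K (f a) (g a) * gram K J f g - (\<Sum>b\<in>J. inner_on K (f a) (g b) * gram K J f (g(b := g a)))"
  unfolding gram_def set_det_insert[OF assms]
  by (intro arg_cong2[where f="(-)"] sum.cong refl arg_cong2[where f="(*)"] set_det_cong) auto

lemma gram_alt:
  assumes "finite J" "a \<in> J" "b \<in> J" "a \<noteq> b" "f a = f b"
  shows "gram K J f g = 0"
  unfolding gram_def using assms by (intro set_det_identical_rows[of J a b]) auto

lemma gram_linear:
  assumes J: "finite J" and b: "b \<in> J"
  shows "gram K J (f(b := \<lambda>k. \<Sum>i\<in>I. c i * h i k)) g = (\<Sum>i\<in>I. c i * gram K J (f(b := h i)) g)"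
proof -
  obtain J' where J': "J = insert b J'" "b \<notin> J'" "finite J'"
    using J b by (metis finite_insert mk_disjoint_insert)
  \<comment> \<open>In the expansion along row \<open>b\<close>, the vector \<open>f b\<close>
    occurs only in the inner products in front; the minors over \<open>J'\<close> do not see
    it.\<close>
  have *: "gram K J' (f(b := x)) g' = gram K J' f g'" for x g'
    using J' by (intro gram_cong) auto
  show ?thesis
    unfolding J'(1) gram_insert[OF J'(3,2)] *
    by (simp add: inner_on_sum_left sum_distrib_right sum_distrib_left sum_subtractf right_diff_distrib
        mult.assoc sum.swap[of _ J' I])
qed

lemma gram_linear_right:
  assumes J: "finite J" and b: "b \<in> J"
  shows "gram K J f (g(b := \<lambda>k. \<Sum>i\<in>I. c i * h i k)) = (\<Sum>i\<in>I. c i * gram K J f (g(b := h i)))"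
  using gram_linear[OF assms, of K g c h I f] by (simp add: gram_sym[OF J, of _ f])

lemma gram_zero: "finite J \<Longrightarrow> b \<in> J \<Longrightarrow> (\<And>k. k \<in> K \<Longrightarrow> x k = 0) \<Longrightarrow> gram K J (f(b := x)) g = 0"
  \<comment> \<open>The zero vector is a linear combination over the empty index set, so
    coefficients and vectors are arbitrary.\<close>
  using gram_linear[of J b K f undefined undefined "{}" g]
  by (simp, subst gram_cong[where f'="f(b := \<lambda>_. 0)"]) auto

text \<open>The quadratic form \<open>Q\<close> of the Gram determinant: \<open>bordered K J f x y\<close> is the Gram determinant of
  \<open>f\<close> with the vectors \<open>x\<close> and \<open>y\<close> adjoined on the two sides (\<open>gram_bordered\<close>), written without a
  fresh index.\<close>
definition bordered :: "'r set \<Rightarrow> 'i set \<Rightarrow> ('i \<Rightarrow> 'r \<Rightarrow> real) \<Rightarrow> ('r \<Rightarrow> real) \<Rightarrow> ('r \<Rightarrow> real) \<Rightarrow> real" where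
  "bordered K J f x y = inner_on K x y * gram K J f f - (\<Sum>b\<in>J. inner_on K x (f b) * gram K J f (f(b := y)))"

section \<open>Algebra of the quadratic form \<open>bordered\<close>\<close>

lemma gram_bordered:
  assumes "finite J" "a \<notin> J" "f a = x" "g a = y" "\<And>i. i \<in> J \<Longrightarrow> f i = h i" "\<And>i. i \<in> J \<Longrightarrow> g i = h i"
  shows "gram K (insert a J) f g = bordered K J h x y"
proof -
  have "gram K J f (g(b := y)) = gram K J h (h(b := y))" for b
    using assms by (intro gram_cong) auto
  moreover have "gram K J f g = gram K J h h"
    using assms by (intro gram_cong) auto
  ultimately show ?thesis
    using assms by (simp add: gram_insert[OF assms(1,2)] bordered_def)
qed

text \<open>The definition treats \<open>x\<close> and \<open>y\<close> differently, but with a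
  fresh index it becomes a Gram determinant, which is symmetric under transposition.
  \<open>J \<noteq> UNIV\<close> supplies that index.\<close>

lemma bordered_sym:
  assumes "finite J" "J \<noteq> UNIV"
  shows "bordered K J f x y = bordered K J f y x"
proof -
  obtain a where a: "a \<notin> J" using assms by auto
  have "bordered K J f x y = gram K (insert a J) (f(a := x)) (f(a := y))"
    using a assms by (intro gram_bordered[symmetric]) auto
  also have "\<dots> = gram K (insert a J) (f(a := y)) (f(a := x))"
    using assms by (intro gram_sym) auto
  also have "\<dots> = bordered K J f y x"
    using a assms by (intro gram_bordered) auto
  finally show ?thesis .
qed

lemma bordered_linear:
  "bordered K J f (\<lambda>k. \<Sum>i\<in>I. c i * h i k) y = (\<Sum>i\<in>I. c i * bordered K J f (h i) y)"
  unfolding bordered_def inner_on_sum_left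
  by (simp add: sum_distrib_right sum_distrib_left sum_subtractf right_diff_distrib mult.assoc
      sum.swap[of _ J I])

lemma bordered_cong:
  assumes "\<And>k. k \<in> K \<Longrightarrow> x k = x' k" "\<And>k. k \<in> K \<Longrightarrow> y k = y' k"
  shows "bordered K J f x y = bordered K J f x' y'"
proof -
  have "inner_on K x z = inner_on K x' z'" if "\<And>k. k \<in> K \<Longrightarrow> z k = z' k" for z z'
    using assms that by (intro inner_on_cong)
  moreover have "gram K J f (f(b := y)) = gram K J f (f(b := y'))" for b
    using assms by (intro gram_cong) auto
  ultimately show ?thesis using assms unfolding bordered_def
    by (intro arg_cong2[where f="(-)"] arg_cong2[where f="(*)"] sum.cong) auto
qed

lemma std_basis_expansion: "finite K \<Longrightarrow> k \<in> K \<Longrightarrow> (\<Sum>i\<in>K. x i * std_basis i k) = x k"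
  by (simp add: std_basis_def if_distrib cong: if_cong)

lemma bordered_units:
  assumes "finite K"
  shows "bordered K J f x y = (\<Sum>i\<in>K. x i * bordered K J f (std_basis i) y)"
  unfolding bordered_linear[symmetric]
  by (intro bordered_cong) (simp_all add: std_basis_expansion assms)

lemma bordered_units2:
  assumes "finite K" "finite J" "J \<noteq> UNIV"
  shows "bordered K J f x y = (\<Sum>i\<in>K. \<Sum>k\<in>K. x i * y k * bordered K J f (std_basis i) (std_basis k))"
proof -
  have "bordered K J f (std_basis i) y = (\<Sum>k\<in>K. y k * bordered K J f (std_basis i) (std_basis k))" for i
    by (subst bordered_sym[OF assms(2,3)], subst bordered_units[OF assms(1)], subst bordered_sym[OF assms(2,3)]) simp
  then show ?thesis
    by (subst bordered_units[OF assms(1)]) (simp add: sum_distrib_left mult.assoc)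
qed

text \<open>Adjoining a member of the family repeats a row; by linearity the form vanishes on the
  span of the family.\<close>

lemma bordered_orth:
  assumes "finite J" "J \<noteq> UNIV" "b \<in> J"
  shows "bordered K J f (f b) y = 0"
proof -
  obtain a where a: "a \<notin> J" using assms by auto
  have "bordered K J f (f b) y = gram K (insert a J) (f(a := f b)) (f(a := y))"
    using a assms by (intro gram_bordered[symmetric]) auto
  also have "\<dots> = 0"
    using a assms by (intro gram_alt[of _ a b]) auto
  finally show ?thesis .
qed

text \<open>\<open>Q x\<close> is \<open>g x\<close> modulo the span of the \<open>f b\<close>, on which the second form vanishes.\<close>
lemma bordered_contract:
  assumes K: "finite K" and J: "finite J" "J \<subseteq> J'" "finite J'" "J' \<noteq> UNIV"
  shows "(\<Sum>k\<in>K. bordered K J f x (std_basis k) * bordered K J' f (std_basis k) y) = gram K J f f * bordered K J' f x y"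
proof -
  have U: "J \<noteq> UNIV" using J by auto
  \<comment> \<open>\<open>w\<close> is the vector \<open>Q x\<close>. The option index gathers the
    multiple of \<open>x\<close> and the multiples of the \<open>f b\<close> in one linear
    combination, so that \<open>bordered_linear\<close> applies.\<close>
  define w where "w k = (\<Sum>z\<in>insert None (Some ` J). (case z of None \<Rightarrow> gram K J f f
      | Some b \<Rightarrow> - gram K J f (f(b := x))) * (case z of None \<Rightarrow> x | Some b \<Rightarrow> f b) k)" for k
  have "bordered K J f x (std_basis k) = w k" if k: "k \<in> K" for k
    using J K k unfolding w_def
    by (subst bordered_sym[OF J(1) U])
       (simp add: bordered_def inner_on_std_basis_left sum.reindex sum_negf mult.commute)
  then have "(\<Sum>k\<in>K. bordered K J f x (std_basis k) * bordered K J' f (std_basis k) y) = bordered K J' f w y"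
    by (simp add: bordered_units[OF K, of J' f w y])
  also have "\<dots> = gram K J f f * bordered K J' f x y
      - (\<Sum>b\<in>J. gram K J f (f(b := x)) * bordered K J' f (f b) y)"
    unfolding w_def bordered_linear using J by (simp add: sum.reindex sum_negf)
  also have "(\<Sum>b\<in>J. gram K J f (f(b := x)) * bordered K J' f (f b) y) = 0"
    using J(2) by (intro sum.neutral ballI) (simp add: bordered_orth[OF J(3,4)] subsetD)
  finally show ?thesis by simp
qed

text \<open>Summing over coordinates reassembles \<open>f b\<close> from its entries, so each
  \<open>b\<close> in \<open>J\<close> subtracts one copy of the Gram determinant from the
  \<open>card K\<close> copies. Geometrically, \<open>Q\<close> is the Gram determinant times a
  projection onto the orthogonal complement of the span.\<close>

lemma bordered_trace:
  assumes K: "finite K" and J: "finite J"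
  shows "(\<Sum>k\<in>K. bordered K J f (std_basis k) (std_basis k)) = (real (card K) - real (card J)) * gram K J f f"
proof -
  have "(\<Sum>k\<in>K. f b k * gram K J f (f(b := std_basis k))) = gram K J f f" if b: "b \<in> J" for b
    unfolding gram_linear_right[OF J b, symmetric]
    by (intro gram_cong) (auto simp: std_basis_expansion K)
  then have "(\<Sum>k\<in>K. \<Sum>b\<in>J. f b k * gram K J f (f(b := std_basis k))) = real (card J) * gram K J f f"
    by (subst sum.swap) simp
  moreover have "bordered K J f (std_basis k) (std_basis k) = gram K J f f - (\<Sum>b\<in>J. f b k * gram K J f (f(b := std_basis k)))"
    if "k \<in> K" for k
    using K that unfolding bordered_def by (simp add: inner_on_std_basis_left) (simp add: std_basis_def)
  ultimately show ?thesis
    using K by (simp add: sum_subtractf left_diff_distrib)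
qed

text \<open>One column at a time: by linearity the change is a multiple of a determinant in which
  \<open>g a\<close> occurs twice.\<close>

lemma gram_col_op:
  assumes J: "finite J" "a \<in> J" and B: "finite B" "B \<subseteq> J - {a}"
  shows "gram K J f (\<lambda>i. if i \<in> B then (\<lambda>k. g i k - c i * g a k) else g i) = gram K J f g"
  using B
proof (induction B)
  case empty
  then show ?case by simp
next
  case (insert b B)
  define g' where "g' = (\<lambda>i. if i \<in> B then (\<lambda>k. g i k - c i * g a k) else g i)"
  have b: "b \<in> J" "b \<noteq> a" "b \<notin> B" "a \<notin> B" using insert by auto
  \<comment> \<open>The sum over the booleans encodes the two-term combination
    \<open>g b - c b * g a\<close> for \<open>gram_linear_right\<close>.\<close>
  have "gram K J f (\<lambda>i. if i \<in> insert b B then (\<lambda>k. g i k - c i * g a k) else g i)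
     = gram K J f (g'(b := \<lambda>k. \<Sum>i\<in>UNIV. (if i then 1 else - c b) * (if i then g b else g a) k))"
    using b by (intro gram_cong) (auto simp: g'_def UNIV_bool)
  also have "\<dots> = gram K J f (g'(b := g b)) - c b * gram K J f (g'(b := g a))"
    by (subst gram_linear_right[OF J(1) b(1)]) (simp add: UNIV_bool)
  also have "gram K J f (g'(b := g a)) = 0"
    using b J by (subst gram_sym) (auto intro!: gram_alt[of J a b] simp: g'_def)
  also have "gram K J f (g'(b := g b)) = gram K J f g'"
    using b by (intro gram_cong) (auto simp: g'_def)
  also have "\<dots> = gram K J f g" using insert unfolding g'_def by auto
  finally show ?case by simp
qed

text \<open>Multiples of \<open>std_basis r\<close> clear coordinate \<open>r\<close> of every
  \<open>f i\<close>, after which inner products only use \<open>K - {r}\<close>. This isolates row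
  \<open>r\<close>: it survives only in the scalars \<open>x r\<close> and
  \<open>f b r\<close>.\<close>

lemma bordered_std_basis_right:
  assumes K: "finite K" "r \<in> K" and J: "finite J" "J \<noteq> UNIV"
  shows "bordered K J f x (std_basis r) =
    x r * gram (K - {r}) J f f - (\<Sum>b\<in>J. f b r * gram (K - {r}) J (f(b := x)) f)"
proof -
  obtain a where a: "a \<notin> J" using J by auto
  define F where "F = f(a := x)"
  define h where "h = (\<lambda>i. if i \<in> J then (\<lambda>k. f i k - f i r * std_basis r k) else (f(a := std_basis r)) i)"
  have ha: "h a = std_basis r" using a by (simp add: h_def)
  have "bordered K J f x (std_basis r) = gram K (insert a J) F (f(a := std_basis r))"
    using a J unfolding F_def by (intro gram_bordered[symmetric]) auto
  also have "\<dots> = gram K (insert a J) F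
      (\<lambda>i. if i \<in> J then (\<lambda>k. (f(a := std_basis r)) i k - f i r * (f(a := std_basis r)) a k) else (f(a := std_basis r)) i)"
    using a J by (intro gram_col_op[symmetric]) auto
  also have "\<dots> = gram K (insert a J) F h"
    using a by (intro gram_cong) (auto simp: h_def)
  \<comment> \<open>The sides are exchanged so that the expanded row is that of
    \<open>std_basis r\<close>, whose inner products are coordinates at \<open>r\<close>.\<close>
  also have "\<dots> = gram K (insert a J) h F"
    using J by (intro gram_sym) auto
  also have "\<dots> = inner_on K (std_basis r) x * gram K J h F - (\<Sum>b\<in>J. inner_on K (std_basis r) (F b) * gram K J h (F(b := x)))"
    unfolding gram_insert[OF J(1) a] ha by (simp add: F_def)
  also have "inner_on K (std_basis r) x = x r" by (simp add: inner_on_std_basis_left K)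
  also have "(\<Sum>b\<in>J. inner_on K (std_basis r) (F b) * gram K J h (F(b := x)))
      = (\<Sum>b\<in>J. f b r * gram (K - {r}) J (f(b := x)) f)"
  proof (intro sum.cong refl)
    fix b assume b: "b \<in> J"
    have "inner_on K (std_basis r) (F b) = f b r"
      using a b by (auto simp: inner_on_std_basis_left K F_def)
    moreover have "gram K J h (F(b := x)) = gram (K - {r}) J f (f(b := x))"
      unfolding gram_def
    proof (rule set_det_cong)
      fix i j assume "i \<in> J" "j \<in> J"
      then show "inner_on K (h i) ((F(b := x)) j) = inner_on (K - {r}) (f i) ((f(b := x)) j)"
        using a by (auto simp: inner_on_def h_def F_def std_basis_def sum.remove[OF K])
    qed
    ultimately show "inner_on K (std_basis r) (F b) * gram K J h (F(b := x)) = f b r * gram (K - {r}) J (f(b := x)) f"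
      using J by (simp add: gram_sym)
  qed
  also have "gram K J h F = gram (K - {r}) J f f"
    unfolding gram_def
  proof (rule set_det_cong)
    fix i j assume "i \<in> J" "j \<in> J"
    then show "inner_on K (h i) (F j) = inner_on (K - {r}) (f i) (f j)"
      using a by (auto simp: inner_on_def h_def F_def std_basis_def sum.remove[OF K])
  qed
  finally show ?thesis .
qed

text \<open>The vector \<open>std_basis r\<close> is zero on \<open>K - {r}\<close>, so every
  correction term vanishes. A diagonal entry of \<open>Q\<close> is therefore free of row
  \<open>r\<close>.\<close>

lemma bordered_std_basis_std_basis:
  assumes K: "finite K" "r \<in> K" and J: "finite J" "J \<noteq> UNIV"
  shows "bordered K J f (std_basis r) (std_basis r) = gram (K - {r}) J f f"
proof -
  have "gram (K - {r}) J (f(b := std_basis r)) f = 0" if "b \<in> J" for b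
    using J that by (intro gram_zero) (auto simp: std_basis_def)
  then show ?thesis by (subst bordered_std_basis_right[OF assms]) (simp add: std_basis_def)
qed

text \<open>This makes \<open>(Q e)_r\<close> affine in the entries \<open>f b r\<close> of row
  \<open>r\<close>, with coefficients that only use the other rows.\<close>

lemma bordered_const_one_std_basis:
  assumes K: "finite K" "r \<in> K" and J: "finite J" "J \<noteq> UNIV"
  shows "bordered K J f (\<lambda>_. 1) (std_basis r) =
    gram (K - {r}) J f f - (\<Sum>b\<in>J. f b r * gram (K - {r}) J (f(b := \<lambda>_. 1)) f)"
  by (simp add: bordered_std_basis_right[OF assms])

section \<open>Generating functions\<close>

text \<open>The parameters will be \<open>m 1\<close>, \<open>cum2\<close>, \<open>cum3\<close>,
  \<open>cum4\<close>; this part is algebra of power series in \<open>t\<close> alone. Their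
  constant series get names so that they act as atoms in ring normalisation.\<close>

locale gf_params =
  fixes a b c \<kappa> :: real
begin

abbreviation "T \<equiv> fps_X :: real fps"
definition "Ca = fps_const a"
definition "Cb = fps_const b"
definition "Cc = fps_const c"
definition "Ck = fps_const \<kappa>"

lemma deriv_consts [simp]: "fps_deriv Ca = 0" "fps_deriv Cb = 0" "fps_deriv Cc = 0" "fps_deriv Ck = 0"
  by (simp_all add: Ca_def Cb_def Cc_def Ck_def)

lemma deriv_power [simp]: "fps_deriv (f ^ n) = of_nat n * f ^ (n - 1) * fps_deriv f" for f :: "real fps"
  by (simp add: fps_deriv_power fps_of_nat)

definition exp_u :: "nat \<Rightarrow> real fps" where
  "exp_u n = fps_exp \<kappa> * inverse (1 - Cb\<^sup>2 * T) ^ n"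

text \<open>The only place where \<open>c\<close> enters the solutions, hence the source of every
  power of \<open>c\<close> in \<open>p_coeff\<close> and \<open>pt_coeff\<close>.\<close>

definition lin_s :: "real fps" where
  "lin_s = 1 + Ca * Cc * T"

text \<open>Solutions of the differential system.  They correspond to the normalised expectations \<open>A\<close>, \<open>B\<close>,
  \<open>C\<close>, \<open>D\<close>, \<open>H\<close> for \<open>n - p\<close> equal to \<open>q\<close>, \<open>q + 1\<close>, \<open>q + 1\<close>, \<open>q + 1\<close>, \<open>q + 2\<close>; below these thresholds the
  expectations vanish.\<close>
definition gC :: "nat \<Rightarrow> real fps" where
  "gC q = exp_u (q + 4) * (of_nat q + 1 + 2 * Cb\<^sup>2 * T)"

definition gB :: "nat \<Rightarrow> real fps" where
  "gB q = lin_s\<^sup>2 * exp_u (q + 4) + Ca\<^sup>2 * Cb * T * gC (q + 1)"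

definition gH :: "nat \<Rightarrow> real fps" where
  "gH q = lin_s * exp_u (q + 4)"

definition gA :: "nat \<Rightarrow> real fps" where
  "gA q = lin_s ^ 4 * exp_u (q + 3) + Ca ^ 4 * T * gC q
    + 2 * Ca\<^sup>2 * Cb * T * lin_s\<^sup>2 * (of_nat q + 3) * exp_u (q + 4)
    + Ca ^ 4 * Cb\<^sup>2 * T\<^sup>2 * (of_nat q + 3) * gC (q + 1)"

definition gD :: "nat \<Rightarrow> real fps" where
  "gD q = lin_s ^ 3 * exp_u (q + 3) + Ca\<^sup>2 * Cb * T * (of_nat q + 3) * lin_s * exp_u (q + 4)"

section \<open>Differential and algebraic relations between the solutions\<close>

lemma u_inverse: "inverse (1 - Cb\<^sup>2 * T) * (1 - Cb\<^sup>2 * T) = 1"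
  by (intro inverse_mult_eq_1) (simp add: Cb_def fps_const_power fps_mult_nth)

lemma exp_u_step: "exp_u n = exp_u (Suc n) * (1 - Cb\<^sup>2 * T)"
  unfolding exp_u_def using u_inverse by (simp add: mult.assoc power_Suc2 del: power_Suc)

lemma deriv_exp_u: "fps_deriv (exp_u n) = of_nat n * Cb\<^sup>2 * exp_u (Suc n) + Ck * exp_u n"
proof -
  let ?u = "inverse (1 - Cb\<^sup>2 * T)"
  have "fps_deriv ?u = Cb\<^sup>2 * ?u\<^sup>2"
    by (subst fps_inverse_deriv) (simp_all add: Cb_def fps_const_power fps_mult_nth)
  then have "fps_deriv (?u ^ n) = of_nat n * Cb\<^sup>2 * ?u ^ (Suc n)"
    by (induction n) (simp_all add: power2_eq_square algebra_simps del: deriv_power)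
  then show ?thesis
    by (simp add: exp_u_def Ck_def algebra_simps)
qed

lemma deriv_lin_s [simp]: "fps_deriv lin_s = Ca * Cc"
  by (simp add: lin_s_def)

text \<open>Generating-function form of \<open>EC_insert\<close>: adjoining a column becomes
  differentiation, the \<open>cum2\<close> term shifts \<open>q\<close>, and row deletion multiplies
  by \<kappa>. With a common exponent in \<open>exp_u\<close> a polynomial identity remains.\<close>

lemma deriv_gC: "fps_deriv (gC q) = Cb\<^sup>2 * (of_nat q + 3) * gC (q + 1) + Ck * gC q"
proof -
  have 1: "exp_u (q + 4) = exp_u (q + 5) * (1 - Cb\<^sup>2 * T)"
    using exp_u_step[of "q + 4"] by (simp_all add: add.commute[of q])
  have 2: "fps_deriv (exp_u (q + 4)) = (of_nat q + 4) * Cb\<^sup>2 * exp_u (q + 5) + Ck * exp_u (q + 4)"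
    using deriv_exp_u[of "q + 4"] by (simp_all add: add.commute[of q])
  have "fps_deriv (gC q) = ((of_nat q + 4) * Cb\<^sup>2 * exp_u (q + 5) + Ck * exp_u (q + 4)) * (of_nat q + 1 + 2 * Cb\<^sup>2 * T)
     + 2 * Cb\<^sup>2 * exp_u (q + 4)"
    unfolding gC_def by (simp add: 2)
  moreover have "gC (q + 1) = exp_u (q + 5) * (of_nat q + 2 + 2 * Cb\<^sup>2 * T)"
    by (simp add: gC_def ac_simps)
  ultimately show ?thesis unfolding gC_def[of q] 1 by (simp add: algebra_simps eval_nat_numeral)
qed

text \<open>Generating-function form of \<open>EB_insert\<close>, where
  \<open>d = q + 2\<close>.\<close>

lemma deriv_gB: "fps_deriv (gB q) =
  Ca\<^sup>2 * Cb * gC (q + 1) + 2 * Ca * Cc * gH q + Cb\<^sup>2 * (of_nat q + 4) * gB (q + 1) + Ck * gB q"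
proof -
  have 2: "fps_deriv (exp_u (q + 4)) = (of_nat q + 4) * Cb\<^sup>2 * exp_u (q + 5) + Ck * exp_u (q + 4)"
    using deriv_exp_u[of "q + 4"] by (simp_all add: add.commute[of q])
  have 3: "fps_deriv (gC (q + 1)) = Cb\<^sup>2 * (of_nat q + 4) * gC (q + 2) + Ck * gC (q + 1)"
    using deriv_gC[of "q + 1"] by simp
  have 4: "gB (q + 1) = lin_s\<^sup>2 * exp_u (q + 5) + Ca\<^sup>2 * Cb * T * gC (q + 2)"
    by (simp add: gB_def ac_simps)
  have "fps_deriv (gB q) = 2 * lin_s * (Ca * Cc) * exp_u (q + 4) + lin_s\<^sup>2 * fps_deriv (exp_u (q + 4))
    + Ca\<^sup>2 * Cb * gC (q + 1) + Ca\<^sup>2 * Cb * T * fps_deriv (gC (q + 1))"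
    by (simp add: gB_def power2_eq_square algebra_simps)
  then show ?thesis unfolding 2 3 4 gH_def gB_def[of q] by (simp add: algebra_simps eval_nat_numeral)
qed

text \<open>Averaging over a row gives an algebraic relation instead of a differential one. Solving
  for \<open>gH q\<close> divides \<open>lin_s\<^sup>2 * exp_u (q + 4)\<close> by
  \<open>lin_s\<close>.\<close>

lemma rec_gH: "gH q = gB q - Ca * T * (Ca * Cb * gC (q + 1) + Cc * gH q)"
  by (simp add: gH_def gB_def lin_s_def algebra_simps power2_eq_square)

text \<open>As for \<open>gH\<close>: moving all \<open>gD\<close> terms to the left produces
  \<open>lin_s * gD q\<close>, and \<open>lin_s\<close> divides the other side.\<close>

lemma rec_gD: "gD q = gA q - Ca * T * (Ca ^ 3 * gC q + Ca * Cb * (of_nat q + 3) * gB q + Cc * gD q)"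
  by (simp add: gD_def gA_def gB_def lin_s_def algebra_simps eval_nat_numeral)

text \<open>Generating-function form of \<open>EA_insert\<close>, where \<open>d = q + 1\<close>;
  thus \<open>2 * d + 4\<close> appears as \<open>2 * q + 6\<close>.\<close>

lemma deriv_gA: "fps_deriv (gA q) = Ca ^ 4 * gC q + Ca\<^sup>2 * Cb * (2 * of_nat q + 6) * gB q
    + Cb\<^sup>2 * (of_nat q + 3) * gA (q + 1) + 4 * Ca * Cc * gD q + Ck * gA q"
proof -
  have 1: "fps_deriv (exp_u (q + 3)) = (of_nat q + 3) * Cb\<^sup>2 * exp_u (q + 4) + Ck * exp_u (q + 3)"
    using deriv_exp_u[of "q + 3"] by (simp_all add: add.commute[of q])
  have 2: "fps_deriv (exp_u (q + 4)) = (of_nat q + 4) * Cb\<^sup>2 * exp_u (q + 5) + Ck * exp_u (q + 4)"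
    using deriv_exp_u[of "q + 4"] by (simp_all add: add.commute[of q])
  have 3: "fps_deriv (gC (q + 1)) = Cb\<^sup>2 * (of_nat q + 4) * gC (q + 2) + Ck * gC (q + 1)"
    using deriv_gC[of "q + 1"] by simp
  have 4: "gA (q + 1) = lin_s ^ 4 * exp_u (q + 4) + Ca ^ 4 * T * gC (q + 1)
    + 2 * Ca\<^sup>2 * Cb * T * lin_s\<^sup>2 * (of_nat q + 4) * exp_u (q + 5)
    + Ca ^ 4 * Cb\<^sup>2 * T\<^sup>2 * (of_nat q + 4) * gC (q + 2)"
    by (simp add: gA_def ac_simps)
  have 5: "gB q = lin_s\<^sup>2 * exp_u (q + 4) + Ca\<^sup>2 * Cb * T * gC (q + 1)" by (simp add: gB_def)
  have "fps_deriv (gA q) = 4 * lin_s ^ 3 * (Ca * Cc) * exp_u (q + 3) + lin_s ^ 4 * fps_deriv (exp_u (q + 3))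
    + Ca ^ 4 * gC q + Ca ^ 4 * T * fps_deriv (gC q)
    + 2 * Ca\<^sup>2 * Cb * lin_s\<^sup>2 * (of_nat q + 3) * exp_u (q + 4)
    + 4 * Ca\<^sup>2 * Cb * T * lin_s * (Ca * Cc) * (of_nat q + 3) * exp_u (q + 4)
    + 2 * Ca\<^sup>2 * Cb * T * lin_s\<^sup>2 * (of_nat q + 3) * fps_deriv (exp_u (q + 4))
    + 2 * Ca ^ 4 * Cb\<^sup>2 * T * (of_nat q + 3) * gC (q + 1)
    + Ca ^ 4 * Cb\<^sup>2 * T\<^sup>2 * (of_nat q + 3) * fps_deriv (gC (q + 1))"
    by (simp add: gA_def algebra_simps)
  then show ?thesis unfolding 1 2 3 4 5 deriv_gC[of q] gD_def gA_def[of q] lin_s_def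
    by (simp add: algebra_simps eval_nat_numeral)
qed

text \<open>Initial values; after normalisation they match the expectations \<open>1\<close>,
  \<open>n\<close>, \<open>n^2\<close> without random columns.\<close>

lemma gf_0 [simp]: "fps_nth (gA q) 0 = 1" "fps_nth (gB q) 0 = 1" "fps_nth (gC q) 0 = of_nat q + 1"
  by (simp_all add: gA_def gB_def gC_def exp_u_def lin_s_def fps_power_zeroth Ca_def Cb_def Cc_def)

lemma gA_closed: "gA q = exp_u (q + 5) *
   (1 + (\<Sum>k = 1..6. fps_const (p_coeff a b c k) * T ^ k)
      + of_nat q * (Ca\<^sup>2 * (\<Sum>k = 1..4. fps_const (pt_coeff a b c k) * T ^ k))
      + of_nat (q * (q - 1)) * (Ca ^ 4 * Cb\<^sup>2 * T\<^sup>2))"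
proof -
  have e: "{1..6} = {1,2,3,4,5,6::nat}" "{1..4} = {1,2,3,4::nat}" by auto
  have 1: "exp_u (q + 3) = exp_u (q + 4) * (1 - Cb\<^sup>2 * T)" "exp_u (q + 4) = exp_u (q + 5) * (1 - Cb\<^sup>2 * T)"
    using exp_u_step[of "q + 3"] exp_u_step[of "q + 4"] by (simp_all add: add.commute[of q])
  \<comment> \<open>Truncated subtraction is harmless: at \<open>q = 0\<close> both sides are
    0.\<close>
  have q: "of_nat (q * (q - 1)) = of_nat q * (of_nat q - 1 :: real fps)"
    by (cases q) (simp_all add: algebra_simps)
  have c: "fps_const (x + y) = fps_const x + fps_const y" "fps_const (x - y) = fps_const x - fps_const y"
    "fps_const (x * y) = fps_const x * fps_const y" "fps_const (x ^ n) = fps_const x ^ n"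
    "fps_const (numeral w) = numeral w" "fps_const (- x) = - fps_const x" for x y :: real and n w
    by (simp_all add: fps_const_power fps_numeral_fps_const)
  have "gC (q + 1) = exp_u (q + 5) * (of_nat q + 2 + 2 * Cb\<^sup>2 * T)" by (simp add: gC_def ac_simps)
  moreover have "gC q = exp_u (q + 5) * (1 - Cb\<^sup>2 * T) * (of_nat q + 1 + 2 * Cb\<^sup>2 * T)"
    by (simp add: gC_def 1)
  ultimately show ?thesis
    unfolding e gA_def 1 q lin_s_def
    apply (simp add: p_coeff_def pt_coeff_def c Ca_def[symmetric] Cb_def[symmetric] Cc_def[symmetric] del: fps_const_add fps_const_mult fps_const_sub fps_const_power fps_const_neg)
    by (simp add: algebra_simps eval_nat_numeral)
qed

lemma const_nth:
  "fps_nth (Ca * f) p = a * fps_nth f p" "fps_nth (Cb * f) p = b * fps_nth f p"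
  "fps_nth (Cc * f) p = c * fps_nth f p" "fps_nth (Ck * f) p = \<kappa> * fps_nth f p"
  "fps_nth (Ca ^ r * f) p = a ^ r * fps_nth f p" "fps_nth (Cb ^ r * f) p = b ^ r * fps_nth f p"
  "fps_nth (of_nat q * f) p = real q * fps_nth f p" "fps_nth (numeral w * f) p = numeral w * fps_nth f p"
  for f :: "real fps"
  by (simp_all add: Ca_def Cb_def Cc_def Ck_def fps_of_nat[symmetric] fps_numeral_fps_const)

lemma gC_nth: "(1 + real p) * fps_nth (gC q) (Suc p) =
    b ^ 2 * (real q + 3) * fps_nth (gC (q + 1)) p + \<kappa> * fps_nth (gC q) p"
  using arg_cong[OF deriv_gC[of q], of "\<lambda>f. fps_nth f p"]
  by (simp add: const_nth mult.assoc distrib_right distrib_left)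

lemma gB_nth: "(1 + real p) * fps_nth (gB q) (Suc p) =
    a ^ 2 * b * fps_nth (gC (q + 1)) p + 2 * a * c * fps_nth (gH q) p
    + b ^ 2 * (real q + 4) * fps_nth (gB (q + 1)) p + \<kappa> * fps_nth (gB q) p"
  using arg_cong[OF deriv_gB[of q], of "\<lambda>f. fps_nth f p"]
  by (simp add: const_nth mult.assoc distrib_right distrib_left)

lemma gA_nth: "(1 + real p) * fps_nth (gA q) (Suc p) = a ^ 4 * fps_nth (gC q) p
    + a ^ 2 * b * (2 * real q + 6) * fps_nth (gB q) p
    + b ^ 2 * (real q + 3) * fps_nth (gA (q + 1)) p
    + 4 * a * c * fps_nth (gD q) p + \<kappa> * fps_nth (gA q) p"
  using arg_cong[OF deriv_gA[of q], of "\<lambda>f. fps_nth f p"]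
  by (simp add: const_nth mult.assoc distrib_right distrib_left)

lemma gH_nth: "fps_nth (gH q) 0 = fps_nth (gB q) 0"
  "fps_nth (gH q) (Suc p) = fps_nth (gB q) (Suc p) - a * (a * b * fps_nth (gC (q + 1)) p + c * fps_nth (gH q) p)"
  by (subst rec_gH; simp add: const_nth mult.assoc distrib_right distrib_left mult.left_commute[of T])+

lemma gD_nth: "fps_nth (gD q) 0 = fps_nth (gA q) 0"
  "fps_nth (gD q) (Suc p) = fps_nth (gA q) (Suc p)
    - a * (a ^ 3 * fps_nth (gC q) p + a * b * (real q + 3) * fps_nth (gB q) p + c * fps_nth (gD q) p)"
  by (subst rec_gD; simp add: const_nth mult.assoc distrib_right distrib_left mult.left_commute[of T])+

end

section \<open>Integrability\<close>

text \<open>The set \<open>I\<close> records which entries of the array may occur, so that disjoint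
  sets yield independent random variables.\<close>

inductive poly_fun :: "'i set \<Rightarrow> (('i \<Rightarrow> real) \<Rightarrow> real) \<Rightarrow> bool" for I where
  poly_fun_const: "poly_fun I (\<lambda>_. c)"
| poly_fun_coord: "i \<in> I \<Longrightarrow> poly_fun I (\<lambda>y. y i)"
| poly_fun_add: "poly_fun I F \<Longrightarrow> poly_fun I G \<Longrightarrow> poly_fun I (\<lambda>y. F y + G y)"
| poly_fun_mult: "poly_fun I F \<Longrightarrow> poly_fun I G \<Longrightarrow> poly_fun I (\<lambda>y. F y * G y)"

lemma poly_fun_sum: "(\<And>a. a \<in> A \<Longrightarrow> poly_fun I (F a)) \<Longrightarrow> poly_fun I (\<lambda>y. \<Sum>a\<in>A. F a y)"
  by (induction A rule: infinite_finite_induct) (auto intro: poly_fun.intros)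

lemma poly_fun_prod: "(\<And>a. a \<in> A \<Longrightarrow> poly_fun I (F a)) \<Longrightarrow> poly_fun I (\<lambda>y. \<Prod>a\<in>A. F a y)"
  by (induction A rule: infinite_finite_induct) (auto intro: poly_fun.intros)

lemma poly_fun_power: "poly_fun I F \<Longrightarrow> poly_fun I (\<lambda>y. F y ^ n)"
  by (induction n) (auto intro: poly_fun.intros)

lemma poly_fun_measurable: "poly_fun I F \<Longrightarrow> F \<in> borel_measurable (PiM I (\<lambda>_. borel))"
  by (induction rule: poly_fun.induct) auto

lemma poly_fun_restrict: "poly_fun I F \<Longrightarrow> F (restrict y I) = F y"
  by (induction rule: poly_fun.induct) auto

lemma poly_fun_inner_on: "(\<And>k. k \<in> K \<Longrightarrow> poly_fun I (\<lambda>y. f y k)) \<Longrightarrow> (\<And>k. k \<in> K \<Longrightarrow> poly_fun I (\<lambda>y. g y k)) \<Longrightarrow>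
    poly_fun I (\<lambda>y. inner_on K (f y) (g y))"
  unfolding inner_on_def by (intro poly_fun_sum poly_fun_mult)

lemma poly_fun_gram:
  assumes "\<And>j k. j \<in> J \<Longrightarrow> k \<in> K \<Longrightarrow> poly_fun I (\<lambda>y. f y j k)" "\<And>j k. j \<in> J \<Longrightarrow> k \<in> K \<Longrightarrow> poly_fun I (\<lambda>y. g y j k)"
  shows "poly_fun I (\<lambda>y. gram K J (f y) (g y))"
  unfolding gram_def set_det_def
  by (intro poly_fun_sum poly_fun_mult poly_fun_const poly_fun_prod poly_fun_inner_on assms) (auto simp: permutes_in_image)

section \<open>Bounds by squared column norms\<close>

lemma abs_inner_on_le: "\<bar>inner_on K x y\<bar> \<le> sqrt (inner_on K x x) * sqrt (inner_on K y y)"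
proof -
  have "(inner_on K x y)\<^sup>2 \<le> inner_on K x x * inner_on K y y"
    using Cauchy_Schwarz_ineq_sum[of x y K] by (simp add: inner_on_def power2_eq_square)
  then have "sqrt ((inner_on K x y)\<^sup>2) \<le> sqrt (inner_on K x x * inner_on K y y)"
    by (rule real_sqrt_le_mono)
  then show ?thesis by (simp add: real_sqrt_mult)
qed

lemma inner_on_self_nonneg: "0 \<le> inner_on K x x"
  by (simp add: inner_on_def sum_nonneg)

text \<open>Cauchy-Schwarz bounds each term of the determinant. A permutation uses every index once
  on either side, so the square roots recombine, and each column contributes only its squared
  norm.\<close>

lemma gram_bound:
  assumes J: "finite J" and f: "\<And>j. j \<in> J \<Longrightarrow> inner_on K (f j) (f j) \<le> s j"
    and g: "\<And>j. j \<in> J \<Longrightarrow> inner_on K (g j) (g j) \<le> s j"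
  shows "\<bar>gram K J f g\<bar> \<le> fact (card J) * (\<Prod>j\<in>J. s j)"
proof -
  have s: "s j \<ge> 0" if "j \<in> J" for j using f[OF that] inner_on_self_nonneg[of K "f j"] by simp
  have "\<bar>gram K J f g\<bar> \<le> (\<Sum>p | p permutes J. \<bar>of_int (sign p) * (\<Prod>i\<in>J. inner_on K (f i) (g (p i)))\<bar>)"
    unfolding gram_def set_det_def by (rule sum_abs)
  also have "\<dots> \<le> (\<Sum>p | p permutes J. \<Prod>j\<in>J. s j)"
  proof (intro sum_mono)
    fix p assume "p \<in> {p. p permutes J}"
    then have p: "p permutes J" by simp
    have "\<bar>of_int (sign p) * (\<Prod>i\<in>J. inner_on K (f i) (g (p i)))\<bar> = (\<Prod>i\<in>J. \<bar>inner_on K (f i) (g (p i))\<bar>)"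
      by (simp add: abs_mult abs_prod sign_def)
    also have "\<dots> \<le> (\<Prod>i\<in>J. sqrt (s i) * sqrt (s (p i)))"
    proof (intro prod_mono conjI)
      fix i assume i: "i \<in> J"
      have pi: "p i \<in> J" using p i by (simp add: permutes_in_image)
      have "\<bar>inner_on K (f i) (g (p i))\<bar> \<le> sqrt (inner_on K (f i) (f i)) * sqrt (inner_on K (g (p i)) (g (p i)))"
        by (rule abs_inner_on_le)
      also have "\<dots> \<le> sqrt (s i) * sqrt (s (p i))"
        using f[OF i] g[OF pi] s[OF i] by (intro mult_mono real_sqrt_le_mono) (auto simp: inner_on_self_nonneg)
      finally show "\<bar>inner_on K (f i) (g (p i))\<bar> \<le> sqrt (s i) * sqrt (s (p i))" .
    qed simp
    also have "\<dots> = (\<Prod>i\<in>J. sqrt (s i)) * (\<Prod>i\<in>J. sqrt (s (p i)))"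
      by (rule prod.distrib)
    also have "(\<Prod>i\<in>J. sqrt (s (p i))) = (\<Prod>i\<in>J. sqrt (s i))"
      using prod.permute[OF p, of "\<lambda>i. sqrt (s i)"] by (simp add: o_def)
    also have "(\<Prod>i\<in>J. sqrt (s i)) * (\<Prod>i\<in>J. sqrt (s i)) = (\<Prod>j\<in>J. s j)"
      unfolding prod.distrib[symmetric] by (intro prod.cong) (auto simp: s)
    finally show "\<bar>of_int (sign p) * (\<Prod>i\<in>J. inner_on K (f i) (g (p i)))\<bar> \<le> (\<Prod>j\<in>J. s j)" .
  qed
  also have "\<dots> = fact (card J) * (\<Prod>j\<in>J. s j)"
    using J by (simp add: card_permutations)
  finally show ?thesis .
qed

text \<open>The index \<open>None\<close> stands for the all-ones vector \<open>e\<close>.\<close>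
definition column :: "(nat \<times> nat \<Rightarrow> real) \<Rightarrow> nat option \<Rightarrow> nat \<Rightarrow> real" where
  "column y j = (case j of None \<Rightarrow> (\<lambda>_. 1) | Some c \<Rightarrow> (\<lambda>i. y (i, c)))"

lemma column_simps [simp]: "column y None = (\<lambda>_. 1)" "column y (Some c) = (\<lambda>i. y (i, c))"
  by (simp_all add: column_def)

text \<open>The summand 1 makes the weights at least 1, so that products of weights grow with the
  index set.\<close>

definition col_weight :: "nat set \<Rightarrow> (nat \<times> nat \<Rightarrow> real) \<Rightarrow> nat option \<Rightarrow> real" where
  "col_weight K y j = 1 + inner_on K (column y j) (column y j)"

lemma col_weight_ge_1: "1 \<le> col_weight K y j"
  by (simp add: col_weight_def inner_on_self_nonneg)

text \<open>Only four moments exist, so integrability of a product of two determinants is obtained from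
  independence of the columns and the bound of each determinant by squared column norms.\<close>
definition dominated :: "nat set \<Rightarrow> nat set \<Rightarrow> ((nat \<times> nat \<Rightarrow> real) \<Rightarrow> real) \<Rightarrow> bool" where
  "dominated K C F \<longleftrightarrow> poly_fun (K \<times> C) F \<and> (\<exists>c J. finite J \<and> (\<forall>y. \<bar>F y\<bar> \<le> c * (\<Prod>j\<in>J. col_weight K y j)))"

text \<open>A random column counts as occurring unless it is overwritten on both sides. Hence a
  fresh index can carry the bordering vectors in \<open>dominated_bordered\<close>.\<close>

lemma dominated_gram:
  assumes J: "finite J" and C: "\<And>c. Some c \<in> J \<Longrightarrow> Some c \<noteq> b \<or> Some c \<noteq> b' \<Longrightarrow> c \<in> C"
  shows "dominated K C (\<lambda>y. gram K J ((column y)(b := x)) ((column y)(b' := x')))"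
  unfolding dominated_def
proof (intro conjI exI allI)
  have 1: "poly_fun (K \<times> C) (\<lambda>y. ((column y)(b := x)) j k)"
    if "k \<in> K" "\<And>c. j = Some c \<Longrightarrow> j \<noteq> b \<Longrightarrow> c \<in> C" for j k b and x :: "nat \<Rightarrow> real"
    using that by (cases j; cases "j = b") (auto intro: poly_fun.intros)
  show "poly_fun (K \<times> C) (\<lambda>y. gram K J ((column y)(b := x)) ((column y)(b' := x')))"
    by (intro poly_fun_gram 1) (use C in auto)
  \<comment> \<open>Chosen to exceed both 1 and the squared norms of the inserted vectors, so
    \<open>c\<close> times the weight bounds a position whether overwritten or not.\<close>
  define c where "c = 1 + inner_on K x x + inner_on K x' x'"
  show "finite J" by fact
  fix y
  have c: "c \<ge> 1" by (simp add: c_def inner_on_self_nonneg)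
  have 2: "inner_on K (((column y)(b := z)) j) (((column y)(b := z)) j) \<le> c * col_weight K y j" if "inner_on K z z \<le> c" for z j b
  proof -
    have "inner_on K (column y j) (column y j) \<le> 1 * col_weight K y j" by (simp add: col_weight_def)
    also have "\<dots> \<le> c * col_weight K y j" using c col_weight_ge_1[of K y j] by (intro mult_right_mono) auto
    moreover have "inner_on K z z \<le> c * 1" using that by simp
    moreover have "c * 1 \<le> c * col_weight K y j" using c col_weight_ge_1[of K y j] by (intro mult_left_mono) auto
    ultimately show ?thesis by auto
  qed
  have "\<bar>gram K J ((column y)(b := x)) ((column y)(b' := x'))\<bar> \<le> fact (card J) * (\<Prod>j\<in>J. c * col_weight K y j)"
    using J by (intro gram_bound 2) (auto simp: c_def inner_on_self_nonneg)
  then show "\<bar>gram K J ((column y)(b := x)) ((column y)(b' := x'))\<bar> \<le> (fact (card J) * c ^ card J) * (\<Prod>j\<in>J. col_weight K y j)"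
    using J by (simp add: prod.distrib mult.assoc)
qed

lemma dominated_gram_column:
  assumes "finite J" "\<And>c. Some c \<in> J \<Longrightarrow> c \<in> C"
  shows "dominated K C (\<lambda>y. gram K J (column y) (column y))"
  \<comment> \<open>\<open>column y None\<close> is already the all-ones vector, so these updates
    change nothing.\<close>
  using dominated_gram[of J None None C K "\<lambda>_. 1" "\<lambda>_. 1"] assms by (simp add: fun_upd_idem)

lemma dominated_gram_one:
  assumes "finite J" "\<And>c. Some c \<in> J \<Longrightarrow> c \<in> C"
  shows "dominated K C (\<lambda>y. gram K J ((column y)(b := x)) (column y))"
  using dominated_gram[of J b None C K x "\<lambda>_. 1"] assms by (simp add: fun_upd_idem)

lemma dominated_bordered:
  assumes J: "finite J" and C: "\<And>c. Some c \<in> J \<Longrightarrow> c \<in> C"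
  shows "dominated K C (\<lambda>y. bordered K J (column y) x x')"
proof -
  obtain a where a: "a \<notin> J"
    using J ex_new_if_finite[of J] by auto
  have "bordered K J (column y) x x' = gram K (insert a J) ((column y)(a := x)) ((column y)(a := x'))" for y
    using a J by (intro gram_bordered[symmetric]) auto
  moreover have "dominated K C (\<lambda>y. gram K (insert a J) ((column y)(a := x)) ((column y)(a := x')))"
    using J C by (intro dominated_gram) auto
  ultimately show ?thesis by simp
qed

text \<open>Single factors become products of powers over a common set; repeated indices are then
  collected by adding exponents.\<close>

lemma prod_pick:
  "finite S \<Longrightarrow> i \<in> S \<Longrightarrow> (\<Prod>l\<in>S. x l ^ (if l = i then 1 else 0 :: nat)) = (x i :: real)"
  by (simp add: if_distrib[of "power _"] cong: if_cong)

section \<open>Independence, moments and integrability of the random array\<close>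

locale iid_array = prob_space +
  fixes X :: "nat \<Rightarrow> nat \<Rightarrow> 'a \<Rightarrow> real" and m :: "nat \<Rightarrow> real"
  assumes indep: "indep_vars (\<lambda>_. borel) (\<lambda>(i, j). X i j) UNIV"
    and int_pow: "\<And>i j r. r \<le> 4 \<Longrightarrow> integrable M (\<lambda>x. X i j x ^ r)"
    and moments: "\<And>i j r. r \<le> 4 \<Longrightarrow> m r = (\<integral>x. X i j x ^ r \<partial>M)"
begin

definition Y :: "'a \<Rightarrow> nat \<times> nat \<Rightarrow> real" where
  "Y \<omega> = (\<lambda>(i, j). X i j \<omega>)"

lemma Y_apply [simp]: "Y \<omega> (i, j) = X i j \<omega>"
  by (simp add: Y_def)

lemma indep_Y: "indep_vars (\<lambda>_. borel) (\<lambda>i \<omega>. Y \<omega> i) UNIV"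
  using indep by (simp add: Y_def case_prod_unfold)

lemma rv_poly_fun: assumes "poly_fun I F" shows "(\<lambda>\<omega>. F (Y \<omega>)) \<in> borel_measurable M"
proof -
  have "(\<lambda>\<omega>. \<lambda>i\<in>I. Y \<omega> i) \<in> measurable M (PiM I (\<lambda>_. borel))"
    using indep_Y by (auto simp: indep_vars_def intro!: measurable_restrict)
  from measurable_compose[OF this poly_fun_measurable[OF assms]] show ?thesis
    by (simp add: poly_fun_restrict[OF assms])
qed

text \<open>Disjoint blocks of an independent family are independent, and a polynomial depends only
  on the restriction to its block.\<close>

lemma
  assumes F: "poly_fun I F" "integrable M (\<lambda>\<omega>. F (Y \<omega>))" and G: "poly_fun I' G" "integrable M (\<lambda>\<omega>. G (Y \<omega>))"
    and I: "I \<inter> I' = {}"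
  shows integrable_block: "integrable M (\<lambda>\<omega>. F (Y \<omega>) * G (Y \<omega>))"
    and integral_block: "(\<integral>\<omega>. F (Y \<omega>) * G (Y \<omega>) \<partial>M) = (\<integral>\<omega>. F (Y \<omega>) \<partial>M) * (\<integral>\<omega>. G (Y \<omega>) \<partial>M)"
proof -
  have "indep_var borel (F \<circ> (\<lambda>\<omega>. \<lambda>i\<in>I. Y \<omega> i)) borel (G \<circ> (\<lambda>\<omega>. \<lambda>i\<in>I'. Y \<omega> i))"
    by (intro indep_var_compose[OF indep_var_restrict[OF indep_Y I]] poly_fun_measurable F G) auto
  then have *: "indep_var borel (\<lambda>\<omega>. F (Y \<omega>)) borel (\<lambda>\<omega>. G (Y \<omega>))"
    by (simp add: o_def poly_fun_restrict[OF F(1)] poly_fun_restrict[OF G(1)])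
  show "integrable M (\<lambda>\<omega>. F (Y \<omega>) * G (Y \<omega>))"
    by (rule indep_var_integrable[OF * F(2) G(2)])
  show "(\<integral>\<omega>. F (Y \<omega>) * G (Y \<omega>) \<partial>M) = (\<integral>\<omega>. F (Y \<omega>) \<partial>M) * (\<integral>\<omega>. G (Y \<omega>) \<partial>M)"
    by (rule indep_var_lebesgue_integral[OF * F(2) G(2)])
qed

lemma
  assumes S: "finite S" and d: "\<And>l. l \<in> S \<Longrightarrow> d l \<le> 4"
  shows integrable_monomial: "integrable M (\<lambda>\<omega>. \<Prod>l\<in>S. X l j \<omega> ^ d l)"
    and integral_monomial: "(\<integral>\<omega>. (\<Prod>l\<in>S. X l j \<omega> ^ d l) \<partial>M) = (\<Prod>l\<in>S. m (d l))"
proof -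
  have "integrable M (\<lambda>\<omega>. \<Prod>l\<in>S. X l j \<omega> ^ d l) \<and> (\<integral>\<omega>. (\<Prod>l\<in>S. X l j \<omega> ^ d l) \<partial>M) = (\<Prod>l\<in>S. m (d l))"
    using S d
  proof (induction S)
    case empty
    then show ?case by (simp add: prob_space)
  next
    case (insert a S)
    have 1: "poly_fun {(a, j)} (\<lambda>y. y (a, j) ^ d a)" by (intro poly_fun_power poly_fun_coord) simp
    have 2: "poly_fun (S \<times> {j}) (\<lambda>y. \<Prod>l\<in>S. y (l, j) ^ d l)" by (intro poly_fun_prod poly_fun_power poly_fun_coord) simp
    have disj: "{(a, j)} \<inter> S \<times> {j} = {}" using insert by auto
    have i1: "integrable M (\<lambda>\<omega>. Y \<omega> (a, j) ^ d a)" using insert by (simp add: int_pow)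
    have i2: "integrable M (\<lambda>\<omega>. \<Prod>l\<in>S. Y \<omega> (l, j) ^ d l)" using insert by simp
    show ?case
      using integrable_block[OF 1 i1 2 i2 disj] integral_block[OF 1 i1 2 i2 disj] insert
      by (simp add: moments[of "d a" a j])
  qed
  then show "integrable M (\<lambda>\<omega>. \<Prod>l\<in>S. X l j \<omega> ^ d l)"
    "(\<integral>\<omega>. (\<Prod>l\<in>S. X l j \<omega> ^ d l) \<partial>M) = (\<Prod>l\<in>S. m (d l))" by auto
qed

definition kron :: "nat \<Rightarrow> nat \<Rightarrow> real" where
  "kron i k = (if i = k then 1 else 0)"

text \<open>Cumulants of an entry; \<open>cum4\<close> is the fourth central moment minus
  \<open>3 * cum2 ^ 2\<close>.\<close>

definition "cum2 = m 2 - m 1 ^ 2"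
definition "cum3 = m 3 - 3 * m 1 * m 2 + 2 * m 1 ^ 3"
definition "cum4 = m 4 - 4 * m 1 * m 3 + 6 * m 1 ^ 2 * m 2 - 3 * m 1 ^ 4 - 3 * cum2 ^ 2"

text \<open>The mixed moments of a column, as a sum over set partitions of products of cumulants.\<close>
definition mom3 :: "nat \<Rightarrow> nat \<Rightarrow> nat \<Rightarrow> real" where
  "mom3 i k r = m 1 ^ 3 + m 1 * cum2 * (kron i k + kron i r + kron k r)
     + cum3 * (kron i k * kron k r)"

definition mom4 :: "nat \<Rightarrow> nat \<Rightarrow> nat \<Rightarrow> nat \<Rightarrow> real" where
  "mom4 i k r s = m 1 ^ 4
     + m 1 ^ 2 * cum2 * (kron i k + kron i r + kron i s + kron k r + kron k s + kron r s)
     + m 1 * cum3 *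
        (kron i k * kron k r + kron i k * kron k s + kron i r * kron r s + kron k r * kron r s)
     + cum2 ^ 2 * (kron i k * kron r s + kron i r * kron k s + kron i s * kron k r)
     + cum4
        * (kron i k * kron k r * kron r s)"

lemma
  shows integrable4: "integrable M (\<lambda>\<omega>. X i j \<omega> * X k j \<omega> * X r j \<omega> * X s j \<omega>)"
    and integral4: "(\<integral>\<omega>. X i j \<omega> * X k j \<omega> * X r j \<omega> * X s j \<omega> \<partial>M) = mom4 i k r s"
proof -
  \<comment> \<open>\<open>d l\<close> counts how often row \<open>l\<close> occurs among
    \<open>i\<close>, \<open>k\<close>, \<open>r\<close>, \<open>s\<close>.\<close>
  define d where "d l = (if l = i then 1 else 0) + (if l = k then 1 else 0)
    + (if l = r then 1 else 0) + (if l = s then 1 else 0 :: nat)" for l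
  have d: "d l \<le> 4" for l by (simp add: d_def)
  have eq: "X i j \<omega> * X k j \<omega> * X r j \<omega> * X s j \<omega> = (\<Prod>l\<in>{i, k, r, s}. X l j \<omega> ^ d l)" for \<omega>
    unfolding d_def power_add prod.distrib by (subst prod_pick, simp, simp)+ simp
  \<comment> \<open>For every pattern of coincidences this is the moment-cumulant identity.\<close>
  have val: "(\<Prod>l\<in>{i, k, r, s}. m (d l)) = mom4 i k r s"
    by (cases "i = k"; cases "i = r"; cases "i = s"; cases "k = r"; cases "k = s"; cases "r = s")
       (simp_all add: d_def mom4_def cum2_def cum3_def cum4_def kron_def numeral_eq_Suc insert_commute algebra_simps)
  show "integrable M (\<lambda>\<omega>. X i j \<omega> * X k j \<omega> * X r j \<omega> * X s j \<omega>)"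
    unfolding eq by (intro integrable_monomial d) auto
  show "(\<integral>\<omega>. X i j \<omega> * X k j \<omega> * X r j \<omega> * X s j \<omega> \<partial>M) = mom4 i k r s"
    unfolding eq val[symmetric] by (intro integral_monomial d) auto
qed

lemma
  shows integrable3: "integrable M (\<lambda>\<omega>. X i j \<omega> * X k j \<omega> * X r j \<omega>)"
    and integral3: "(\<integral>\<omega>. X i j \<omega> * X k j \<omega> * X r j \<omega> \<partial>M) = mom3 i k r"
proof -
  define d where "d l = (if l = i then 1 else 0) + (if l = k then 1 else 0)
    + (if l = r then 1 else 0 :: nat)" for l
  have d: "d l \<le> 4" for l by (simp add: d_def)
  have eq: "X i j \<omega> * X k j \<omega> * X r j \<omega> = (\<Prod>l\<in>{i, k, r}. X l j \<omega> ^ d l)" for \<omega>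
    unfolding d_def power_add prod.distrib by (subst prod_pick, simp, simp)+ simp
  have val: "(\<Prod>l\<in>{i, k, r}. m (d l)) = mom3 i k r"
    by (cases "i = k"; cases "i = r"; cases "k = r")
       (simp_all add: d_def mom3_def cum2_def cum3_def kron_def numeral_eq_Suc insert_commute algebra_simps)
  show "integrable M (\<lambda>\<omega>. X i j \<omega> * X k j \<omega> * X r j \<omega>)"
    unfolding eq by (intro integrable_monomial d) auto
  show "(\<integral>\<omega>. X i j \<omega> * X k j \<omega> * X r j \<omega> \<partial>M) = mom3 i k r"
    unfolding eq val[symmetric] by (intro integral_monomial d) auto
qed

text \<open>The square expands into monomials of degree at most four in the entries of one column,
  as far as the moments reach.\<close>

lemma integrable_col_weight_squared:
  assumes K: "finite K"
  shows "integrable M (\<lambda>\<omega>. (col_weight K (Y \<omega>) j)\<^sup>2)"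
proof (cases j)
  case None
  then show ?thesis by (simp add: col_weight_def)
next
  case (Some c)
  have "integrable M (\<lambda>\<omega>. X k c \<omega> * X k c \<omega>)" for k
    using int_pow[of 2 k c] by (simp add: power2_eq_square)
  moreover have "(col_weight K (Y \<omega>) j)\<^sup>2 = 1 + 2 * (\<Sum>k\<in>K. X k c \<omega> * X k c \<omega>)
      + (\<Sum>k\<in>K. \<Sum>l\<in>K. X k c \<omega> * X k c \<omega> * X l c \<omega> * X l c \<omega>)" for \<omega>
    by (simp add: Some col_weight_def inner_on_def power2_eq_square algebra_simps sum_product)
  ultimately show ?thesis
    by (auto intro!: Bochner_Integration.integrable_add Bochner_Integration.integrable_sum integrable4)
qed

lemma poly_fun_col_weight: "K \<times> {c. j = Some c} \<subseteq> I \<Longrightarrow> poly_fun I (\<lambda>y. col_weight K y j)"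
  unfolding col_weight_def by (intro poly_fun.intros poly_fun_inner_on; cases j) (auto intro: poly_fun.intros)

text \<open>Distinct columns occupy disjoint blocks, so independence splits off one factor at a
  time; the block of \<open>None\<close> is empty.\<close>

lemma integrable_prod_col_weight:
  assumes K: "finite K" and J: "finite J"
  shows "integrable M (\<lambda>\<omega>. (\<Prod>j\<in>J. col_weight K (Y \<omega>) j)\<^sup>2)"
  using J
proof (induction J)
  case empty
  then show ?case by simp
next
  case (insert a J)
  have 1: "poly_fun (K \<times> {c. a = Some c}) (\<lambda>y. (col_weight K y a)\<^sup>2)"
    by (intro poly_fun_power poly_fun_col_weight) auto
  have 2: "poly_fun (K \<times> {c. Some c \<in> J}) (\<lambda>y. (\<Prod>j\<in>J. col_weight K y j)\<^sup>2)"
    by (intro poly_fun_power poly_fun_prod poly_fun_col_weight) auto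
  have "integrable M (\<lambda>\<omega>. (col_weight K (Y \<omega>) a)\<^sup>2 * (\<Prod>j\<in>J. col_weight K (Y \<omega>) j)\<^sup>2)"
    using insert by (intro integrable_block[OF 1 _ 2] integrable_col_weight_squared K) auto
  then show ?case using insert by (simp add: power_mult_distrib)
qed

text \<open>Both index sets are enlarged to their union, which only increases the bounds; the
  product is then dominated by a multiple of one squared product of weights.\<close>

lemma integrable_dominated:
  assumes K: "finite K" and F: "dominated K C F" and G: "dominated K C' G"
  shows "integrable M (\<lambda>\<omega>. F (Y \<omega>) * G (Y \<omega>))"
proof -
  obtain c J where J: "finite J" "\<And>y. \<bar>F y\<bar> \<le> c * (\<Prod>j\<in>J. col_weight K y j)"
    using F unfolding dominated_def by auto
  obtain c' J' where J': "finite J'" "\<And>y. \<bar>G y\<bar> \<le> c' * (\<Prod>j\<in>J'. col_weight K y j)"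
    using G unfolding dominated_def by auto
  let ?P = "\<lambda>y. \<Prod>j\<in>J \<union> J'. col_weight K y j"
  have sz0: "0 \<le> col_weight K y j" for y j using col_weight_ge_1[of K y j] by simp
  have bnd: "\<bar>H y\<bar> \<le> \<bar>d\<bar> * ?P y"
    if "\<bar>H y\<bar> \<le> d * (\<Prod>j\<in>A. col_weight K y j)" "A \<subseteq> J \<union> J'" for H d y A
  proof -
    have "(\<Prod>j\<in>A. col_weight K y j) \<le> ?P y"
      using that J J' by (intro prod_mono2) (auto simp: col_weight_ge_1 sz0)
    then have "\<bar>d\<bar> * (\<Prod>j\<in>A. col_weight K y j) \<le> \<bar>d\<bar> * ?P y" by (rule mult_left_mono) simp
    moreover have "d * (\<Prod>j\<in>A. col_weight K y j) \<le> \<bar>d\<bar> * (\<Prod>j\<in>A. col_weight K y j)"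
      by (intro mult_right_mono prod_nonneg) (auto simp: sz0)
    ultimately show ?thesis using that by linarith
  qed
  have meas: "(\<lambda>\<omega>. F (Y \<omega>) * G (Y \<omega>)) \<in> borel_measurable M"
    using F G unfolding dominated_def by (intro borel_measurable_times rv_poly_fun) auto
  show ?thesis
  proof (rule Bochner_Integration.integrable_bound[OF _ meas])
    show "integrable M (\<lambda>\<omega>. \<bar>c\<bar> * \<bar>c'\<bar> * (?P (Y \<omega>))\<^sup>2)"
      using J J' K by (intro integrable_mult_right integrable_prod_col_weight) auto
    show "AE \<omega> in M. norm (F (Y \<omega>) * G (Y \<omega>)) \<le> norm (\<bar>c\<bar> * \<bar>c'\<bar> * (?P (Y \<omega>))\<^sup>2)"
    proof (intro AE_I2)
      fix \<omega>
      have "\<bar>F (Y \<omega>)\<bar> * \<bar>G (Y \<omega>)\<bar> \<le> (\<bar>c\<bar> * ?P (Y \<omega>)) * (\<bar>c'\<bar> * ?P (Y \<omega>))"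
        using bnd[of F "Y \<omega>" c J, OF J(2)] bnd[of G "Y \<omega>" c' J', OF J'(2)] by (intro mult_mono) auto
      then show "norm (F (Y \<omega>) * G (Y \<omega>)) \<le> norm (\<bar>c\<bar> * \<bar>c'\<bar> * (?P (Y \<omega>))\<^sup>2)"
        by (simp add: abs_mult power2_eq_square mult_ac)
    qed
  qed
qed

text \<open>Integrates out column \<open>j\<close>: the coefficients only involve the columns in
  \<open>C\<close>, so each monomial in column \<open>j\<close> may be replaced by its mean.\<close>

lemma integral_quartic:
  assumes K: "finite K" and j: "j \<notin> C" and Q: "\<And>i k. dominated K C (Q i k)" and R: "\<And>i k. dominated K C (R i k)"
  shows "(\<integral>\<omega>. (\<Sum>i\<in>K. \<Sum>k\<in>K. X i j \<omega> * X k j \<omega> * Q i k (Y \<omega>)) *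
      (\<Sum>r\<in>K. \<Sum>s\<in>K. X r j \<omega> * X s j \<omega> * R r s (Y \<omega>)) \<partial>M)
    = (\<integral>\<omega>. (\<Sum>i\<in>K. \<Sum>k\<in>K. \<Sum>r\<in>K. \<Sum>s\<in>K. mom4 i k r s * (Q i k (Y \<omega>) * R r s (Y \<omega>))) \<partial>M)"
proof -
  let ?x = "\<lambda>i k r s \<omega>. X i j \<omega> * X k j \<omega> * X r j \<omega> * X s j \<omega>"
  have int: "integrable M (\<lambda>\<omega>. Q i k (Y \<omega>) * R r s (Y \<omega>))" for i k r s
    by (rule integrable_dominated[OF K Q R])
  have block: "integrable M (\<lambda>\<omega>. ?x i k r s \<omega> * (Q i k (Y \<omega>) * R r s (Y \<omega>))) \<and>
      (\<integral>\<omega>. ?x i k r s \<omega> * (Q i k (Y \<omega>) * R r s (Y \<omega>)) \<partial>M)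
      = mom4 i k r s * (\<integral>\<omega>. Q i k (Y \<omega>) * R r s (Y \<omega>) \<partial>M)"
    for i k r s
  proof -
    let ?F = "\<lambda>y. y (i, j) * y (k, j) * y (r, j) * y (s, j)" and ?G = "\<lambda>y. Q i k y * R r s y"
    have F: "poly_fun (UNIV \<times> {j}) ?F" by (intro poly_fun_mult poly_fun_coord) auto
    have G: "poly_fun (K \<times> C) ?G" using Q R unfolding dominated_def by (intro poly_fun_mult) auto
    have "UNIV \<times> {j} \<inter> K \<times> C = {}" using j by auto
    from integrable_block[OF F _ G int this] integral_block[OF F _ G int this]
    show ?thesis by (simp add: integrable4 integral4)
  qed
  have "(\<integral>\<omega>. (\<Sum>i\<in>K. \<Sum>k\<in>K. X i j \<omega> * X k j \<omega> * Q i k (Y \<omega>)) *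
      (\<Sum>r\<in>K. \<Sum>s\<in>K. X r j \<omega> * X s j \<omega> * R r s (Y \<omega>)) \<partial>M)
    = (\<integral>\<omega>. (\<Sum>i\<in>K. \<Sum>k\<in>K. \<Sum>r\<in>K. \<Sum>s\<in>K. ?x i k r s \<omega> * (Q i k (Y \<omega>) * R r s (Y \<omega>))) \<partial>M)"
    unfolding sum_distrib_right unfolding sum_distrib_left by (simp only: mult_ac)
  also have "\<dots> = (\<Sum>i\<in>K. \<Sum>k\<in>K. \<Sum>r\<in>K. \<Sum>s\<in>K. mom4 i k r s * (\<integral>\<omega>. Q i k (Y \<omega>) * R r s (Y \<omega>) \<partial>M))"
    by (simp add: block Bochner_Integration.integral_sum Bochner_Integration.integrable_sum)
  also have "\<dots> = (\<integral>\<omega>. (\<Sum>i\<in>K. \<Sum>k\<in>K. \<Sum>r\<in>K. \<Sum>s\<in>K. mom4 i k r s * (Q i k (Y \<omega>) * R r s (Y \<omega>))) \<partial>M)"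
    by (simp add: int Bochner_Integration.integral_sum Bochner_Integration.integrable_sum)
  finally show ?thesis .
qed

lemma integral_cubic:
  assumes K: "finite K" and j: "j \<notin> C" and W: "\<And>i. dominated K C (W i)" and R: "\<And>i k. dominated K C (R i k)"
  shows "(\<integral>\<omega>. (\<Sum>i\<in>K. X i j \<omega> * W i (Y \<omega>)) *
      (\<Sum>r\<in>K. \<Sum>s\<in>K. X r j \<omega> * X s j \<omega> * R r s (Y \<omega>)) \<partial>M)
    = (\<integral>\<omega>. (\<Sum>i\<in>K. \<Sum>r\<in>K. \<Sum>s\<in>K. mom3 i r s * (W i (Y \<omega>) * R r s (Y \<omega>))) \<partial>M)"
proof -
  let ?x = "\<lambda>i r s \<omega>. X i j \<omega> * X r j \<omega> * X s j \<omega>"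
  have int: "integrable M (\<lambda>\<omega>. W i (Y \<omega>) * R r s (Y \<omega>))" for i r s
    by (rule integrable_dominated[OF K W R])
  have block: "integrable M (\<lambda>\<omega>. ?x i r s \<omega> * (W i (Y \<omega>) * R r s (Y \<omega>))) \<and>
      (\<integral>\<omega>. ?x i r s \<omega> * (W i (Y \<omega>) * R r s (Y \<omega>)) \<partial>M)
      = mom3 i r s * (\<integral>\<omega>. W i (Y \<omega>) * R r s (Y \<omega>) \<partial>M)"
    for i r s
  proof -
    let ?F = "\<lambda>y. y (i, j) * y (r, j) * y (s, j)" and ?G = "\<lambda>y. W i y * R r s y"
    have F: "poly_fun (UNIV \<times> {j}) ?F" by (intro poly_fun_mult poly_fun_coord) auto
    have G: "poly_fun (K \<times> C) ?G" using W R unfolding dominated_def by (intro poly_fun_mult) auto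
    have "UNIV \<times> {j} \<inter> K \<times> C = {}" using j by auto
    from integrable_block[OF F _ G int this] integral_block[OF F _ G int this]
    show ?thesis by (simp add: integrable3 integral3)
  qed
  have "(\<integral>\<omega>. (\<Sum>i\<in>K. X i j \<omega> * W i (Y \<omega>)) *
      (\<Sum>r\<in>K. \<Sum>s\<in>K. X r j \<omega> * X s j \<omega> * R r s (Y \<omega>)) \<partial>M)
    = (\<integral>\<omega>. (\<Sum>i\<in>K. \<Sum>r\<in>K. \<Sum>s\<in>K. ?x i r s \<omega> * (W i (Y \<omega>) * R r s (Y \<omega>))) \<partial>M)"
    unfolding sum_distrib_right unfolding sum_distrib_left by (simp only: mult_ac)
  also have "\<dots> = (\<Sum>i\<in>K. \<Sum>r\<in>K. \<Sum>s\<in>K. mom3 i r s * (\<integral>\<omega>. W i (Y \<omega>) * R r s (Y \<omega>) \<partial>M))"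
    by (simp add: block Bochner_Integration.integral_sum Bochner_Integration.integrable_sum)
  also have "\<dots> = (\<integral>\<omega>. (\<Sum>i\<in>K. \<Sum>r\<in>K. \<Sum>s\<in>K. mom3 i r s * (W i (Y \<omega>) * R r s (Y \<omega>))) \<partial>M)"
    by (simp add: int Bochner_Integration.integral_sum Bochner_Integration.integrable_sum)
  finally show ?thesis .
qed

text \<open>An entry of a row outside \<open>K\<close> is independent of everything computed from
  the rows in \<open>K\<close>, whichever columns occur.\<close>

lemma integral_linear:
  assumes K: "finite K" and i: "i \<notin> K" and F: "dominated K C F" and G: "dominated K C' G"
  shows "(\<integral>\<omega>. X i j \<omega> * (F (Y \<omega>) * G (Y \<omega>)) \<partial>M) = m 1 * (\<integral>\<omega>. F (Y \<omega>) * G (Y \<omega>) \<partial>M)"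
    and "integrable M (\<lambda>\<omega>. X i j \<omega> * (F (Y \<omega>) * G (Y \<omega>)))"
proof -
  have int: "integrable M (\<lambda>\<omega>. F (Y \<omega>) * G (Y \<omega>))" by (rule integrable_dominated[OF K F G])
  have 1: "poly_fun {(i, j)} (\<lambda>y. y (i, j))" by (intro poly_fun_coord) simp
  have mono: "poly_fun I H \<Longrightarrow> I \<subseteq> I' \<Longrightarrow> poly_fun I' H" for I I' H
    by (induction rule: poly_fun.induct) (auto intro: poly_fun.intros)
  have 2: "poly_fun (K \<times> UNIV) (\<lambda>y. F y * G y)"
    using F G unfolding dominated_def by (intro poly_fun_mult) (auto intro: mono)
  have disj: "{(i, j)} \<inter> K \<times> UNIV = {}" using i by auto
  have 3: "integrable M (\<lambda>\<omega>. Y \<omega> (i, j))" using int_pow[of 1 i j] by simp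
  show "(\<integral>\<omega>. X i j \<omega> * (F (Y \<omega>) * G (Y \<omega>)) \<partial>M) = m 1 * (\<integral>\<omega>. F (Y \<omega>) * G (Y \<omega>) \<partial>M)"
    using integral_block[OF 1 3 2 int disj] moments[of 1 i j] by simp
  show "integrable M (\<lambda>\<omega>. X i j \<omega> * (F (Y \<omega>) * G (Y \<omega>)))"
    using integrable_block[OF 1 3 2 int disj] by simp
qed

text \<open>Each partition of the indices in \<open>mom4\<close> contracts the sum: a pair within
  one matrix gives a trace, a cross pair joins two row sums, two cross pairs give an entrywise
  product. By symmetry the four cross pairs agree, which accounts for the factors 4 and 2.\<close>

lemma contract4:
  assumes K: "finite K" and Q: "\<And>i k. Q i k = Q k i" and R: "\<And>i k. R i k = R k i"
  defines "rQ \<equiv> \<lambda>i. \<Sum>k\<in>K. Q i k" and "rR \<equiv> \<lambda>i. \<Sum>k\<in>K. R i k"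
  shows "(\<Sum>i\<in>K. \<Sum>k\<in>K. \<Sum>r\<in>K. \<Sum>s\<in>K. mom4 i k r s * (Q i k * R r s)) =
     m 1 ^ 4 * ((\<Sum>i\<in>K. rQ i) * (\<Sum>i\<in>K. rR i))
   + m 1 ^ 2 * cum2 * ((\<Sum>i\<in>K. Q i i) * (\<Sum>i\<in>K. rR i) + (\<Sum>i\<in>K. rQ i) * (\<Sum>i\<in>K. R i i)
       + 4 * (\<Sum>i\<in>K. rQ i * rR i))
   + 2 * m 1 * cum3 * ((\<Sum>i\<in>K. Q i i * rR i) + (\<Sum>i\<in>K. rQ i * R i i))
   + cum2 ^ 2 * ((\<Sum>i\<in>K. Q i i) * (\<Sum>i\<in>K. R i i) + 2 * (\<Sum>i\<in>K. \<Sum>k\<in>K. Q i k * R i k))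
   + cum4 * (\<Sum>i\<in>K. Q i i * R i i)"
proof -
  \<comment> \<open>As a linear functional of the weight, \<open>P\<close> can be evaluated on the
    terms of \<open>mom4\<close> one by one.\<close>
  define P where "P f = (\<Sum>i\<in>K. \<Sum>k\<in>K. \<Sum>r\<in>K. \<Sum>s\<in>K. f i k r s * (Q i k * R r s))" for f :: "nat \<Rightarrow> nat \<Rightarrow> nat \<Rightarrow> nat \<Rightarrow> real"
  have lin: "P (\<lambda>i k r s. f i k r s + g i k r s) = P f + P g" "P (\<lambda>i k r s. c * f i k r s) = c * P f"
    for f g :: "nat \<Rightarrow> nat \<Rightarrow> nat \<Rightarrow> nat \<Rightarrow> real" and c
    by (simp_all add: P_def sum.distrib sum_distrib_left algebra_simps)
  have kron: "(\<Sum>k\<in>K. kron i k * f k) = f i" if "i \<in> K" for i f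
    using K that by (simp add: kron_def if_distrib[of "\<lambda>x. x * _"] cong: if_cong)
  note S = P_def mult.assoc sum_distrib_left[symmetric] kron
  have c: "(\<Sum>k\<in>K. Q k i) = rQ i" "(\<Sum>k\<in>K. R k i) = rR i" for i
    by (simp_all add: rQ_def rR_def Q[of _ i] R[of _ i])
  have sw: "(\<Sum>i\<in>K. \<Sum>k\<in>K. Q i k * f k) = (\<Sum>k\<in>K. rQ k * f k)" for f
    by (subst sum.swap) (simp add: c sum_distrib_right[symmetric])
  have rw: "(\<Sum>k\<in>K. Q i k * f i) = rQ i * f i" for i f
    by (simp add: rQ_def sum_distrib_right)
  have P0: "P (\<lambda>i k r s. 1) = (\<Sum>i\<in>K. rQ i) * (\<Sum>i\<in>K. rR i)"
    by (simp add: P_def sum_distrib_left[symmetric] sum_distrib_right[symmetric] rQ_def rR_def)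
  have Pik: "P (\<lambda>i k r s. kron i k) = (\<Sum>i\<in>K. Q i i) * (\<Sum>i\<in>K. rR i)"
    by (simp add: S sum_distrib_right[symmetric] rR_def cong: sum.cong)
  have Pir: "P (\<lambda>i k r s. kron i r) = (\<Sum>i\<in>K. rQ i * rR i)"
    by (simp add: S sum_distrib_right[symmetric] rR_def rQ_def cong: sum.cong)
  have Pis: "P (\<lambda>i k r s. kron i s) = (\<Sum>i\<in>K. rQ i * rR i)"
    by (simp add: S c sum_distrib_right[symmetric] rQ_def cong: sum.cong)
  have Pkr: "P (\<lambda>i k r s. kron k r) = (\<Sum>i\<in>K. rQ i * rR i)"
    by (simp add: S sw rR_def cong: sum.cong)
  have Pks: "P (\<lambda>i k r s. kron k s) = (\<Sum>i\<in>K. rQ i * rR i)"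
    by (simp add: S c sw cong: sum.cong)
  have Prs: "P (\<lambda>i k r s. kron r s) = (\<Sum>i\<in>K. rQ i) * (\<Sum>i\<in>K. R i i)"
    by (simp add: S sum_distrib_right[symmetric] rQ_def cong: sum.cong)
  have Pikr: "P (\<lambda>i k r s. kron i k * kron k r) = (\<Sum>i\<in>K. Q i i * rR i)"
    by (simp add: S rR_def cong: sum.cong)
  have Piks: "P (\<lambda>i k r s. kron i k * kron k s) = (\<Sum>i\<in>K. Q i i * rR i)"
    by (simp add: S c cong: sum.cong)
  have Pirs: "P (\<lambda>i k r s. kron i r * kron r s) = (\<Sum>i\<in>K. rQ i * R i i)"
    by (simp add: S rw cong: sum.cong)
  have Pkrs: "P (\<lambda>i k r s. kron k r * kron r s) = (\<Sum>i\<in>K. rQ i * R i i)"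
    by (simp add: S sw cong: sum.cong)
  have Pik_rs: "P (\<lambda>i k r s. kron i k * kron r s) = (\<Sum>i\<in>K. Q i i) * (\<Sum>i\<in>K. R i i)"
    by (simp add: S sum_distrib_right[symmetric] cong: sum.cong)
  have Pir_ks: "P (\<lambda>i k r s. kron i r * kron k s) = (\<Sum>i\<in>K. \<Sum>k\<in>K. Q i k * R i k)"
    by (simp add: S cong: sum.cong)
  have Pis_kr: "P (\<lambda>i k r s. kron i s * kron k r) = (\<Sum>i\<in>K. \<Sum>k\<in>K. Q i k * R i k)"
  proof -
    have "P (\<lambda>i k r s. kron i s * kron k r) = P (\<lambda>i k r s. kron k r * kron i s)" by (simp add: mult.commute)
    also have "\<dots> = (\<Sum>i\<in>K. \<Sum>k\<in>K. Q i k * R k i)" by (simp add: S cong: sum.cong)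
    finally show ?thesis by (simp add: R)
  qed
  have Pikrs: "P (\<lambda>i k r s. kron i k * kron k r * kron r s) = (\<Sum>i\<in>K. Q i i * R i i)"
    by (simp add: S cong: sum.cong)
  have L: "(\<Sum>i\<in>K. \<Sum>k\<in>K. \<Sum>r\<in>K. \<Sum>s\<in>K. mom4 i k r s * (Q i k * R r s)) = P mom4"
    by (simp add: P_def)
  \<comment> \<open>The factor 1 gives the constant term the shape required by the scaling rule in
    \<open>lin\<close>.\<close>
  have M: "mom4 = (\<lambda>i k r s. m 1 ^ 4 * 1
     + m 1 ^ 2 * cum2 * (kron i k + kron i r + kron i s + kron k r + kron k s + kron r s)
     + m 1 * cum3 *
        (kron i k * kron k r + kron i k * kron k s + kron i r * kron r s + kron k r * kron r s)
     + cum2 ^ 2 * (kron i k * kron r s + kron i r * kron k s + kron i s * kron k r)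
     + cum4
        * (kron i k * kron k r * kron r s))"
    unfolding mom4_def by simp
  show ?thesis
    unfolding L unfolding M lin P0 Pik Pir Pis Pkr Pks Prs Pikr Piks Pirs Pkrs Pik_rs Pir_ks Pis_kr Pikrs
    by (simp add: algebra_simps)
qed

lemma contract3:
  assumes K: "finite K" and R: "\<And>i k. R i k = R k i"
  defines "rR \<equiv> \<lambda>i. \<Sum>k\<in>K. R i k"
  shows "(\<Sum>i\<in>K. \<Sum>r\<in>K. \<Sum>s\<in>K. mom3 i r s * (W i * R r s)) =
     m 1 ^ 3 * ((\<Sum>i\<in>K. W i) * (\<Sum>i\<in>K. rR i))
   + m 1 * cum2 * ((\<Sum>i\<in>K. W i) * (\<Sum>i\<in>K. R i i) + 2 * (\<Sum>i\<in>K. W i * rR i))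
   + cum3 * (\<Sum>i\<in>K. W i * R i i)"
proof -
  define P where "P f = (\<Sum>i\<in>K. \<Sum>r\<in>K. \<Sum>s\<in>K. f i r s * (W i * R r s))" for f :: "nat \<Rightarrow> nat \<Rightarrow> nat \<Rightarrow> real"
  have lin: "P (\<lambda>i r s. f i r s + g i r s) = P f + P g" "P (\<lambda>i r s. c * f i r s) = c * P f"
    for f g :: "nat \<Rightarrow> nat \<Rightarrow> nat \<Rightarrow> real" and c
    by (simp_all add: P_def sum.distrib sum_distrib_left algebra_simps)
  have kron: "(\<Sum>k\<in>K. kron i k * f k) = f i" if "i \<in> K" for i f
    using K that by (simp add: kron_def if_distrib[of "\<lambda>x. x * _"] cong: if_cong)
  note S = P_def mult.assoc sum_distrib_left[symmetric] kron
  have c: "(\<Sum>k\<in>K. R k i) = rR i" for i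
    by (simp_all add: rR_def R[of _ i])
  have P0: "P (\<lambda>i r s. 1) = (\<Sum>i\<in>K. W i) * (\<Sum>i\<in>K. rR i)"
    by (simp add: P_def sum_distrib_left[symmetric] sum_distrib_right[symmetric] rR_def)
  have Pir: "P (\<lambda>i r s. kron i r) = (\<Sum>i\<in>K. W i * rR i)"
    by (simp add: S rR_def cong: sum.cong)
  have Pis: "P (\<lambda>i r s. kron i s) = (\<Sum>i\<in>K. W i * rR i)"
    by (simp add: S c cong: sum.cong)
  have Prs: "P (\<lambda>i r s. kron r s) = (\<Sum>i\<in>K. W i) * (\<Sum>i\<in>K. R i i)"
    by (simp add: S sum_distrib_right[symmetric] cong: sum.cong)
  have Pirs: "P (\<lambda>i r s. kron i r * kron r s) = (\<Sum>i\<in>K. W i * R i i)"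
    by (simp add: S cong: sum.cong)
  have L: "(\<Sum>i\<in>K. \<Sum>r\<in>K. \<Sum>s\<in>K. mom3 i r s * (W i * R r s)) = P mom3"
    by (simp add: P_def)
  have M: "mom3 = (\<lambda>i r s. m 1 ^ 3 * 1 + m 1 * cum2 * (kron i r + kron i s + kron r s)
     + cum3 * (kron i r * kron r s))"
    unfolding mom3_def by simp
  show ?thesis
    unfolding L unfolding M lin P0 Pir Pis Prs Pirs by (simp add: algebra_simps)
qed

end

section \<open>Recurrences for the expectations\<close>

context iid_array
begin

abbreviation V :: "'a \<Rightarrow> nat option \<Rightarrow> nat \<Rightarrow> real" where
  "V \<omega> \<equiv> column (Y \<omega>)"

abbreviation cols :: "nat set \<Rightarrow> nat option set" where
  "cols J \<equiv> Some ` J"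

abbreviation cols1 :: "nat set \<Rightarrow> nat option set" where
  "cols1 J \<equiv> insert None (Some ` J)"

abbreviation one :: "nat \<Rightarrow> real" where
  "one \<equiv> (\<lambda>_. 1)"

definition "EA K J = (\<integral>\<omega>. gram K (cols J) (V \<omega>) (V \<omega>) * gram K (cols J) (V \<omega>) (V \<omega>) \<partial>M)"
definition "EB K J = (\<integral>\<omega>. gram K (cols J) (V \<omega>) (V \<omega>) * gram K (cols1 J) (V \<omega>) (V \<omega>) \<partial>M)"
definition "EC K J = (\<integral>\<omega>. gram K (cols1 J) (V \<omega>) (V \<omega>) * gram K (cols1 J) (V \<omega>) (V \<omega>) \<partial>M)"
definition "ED K J = (\<Sum>i\<in>K. \<integral>\<omega>. bordered K (cols J) (V \<omega>) one (std_basis i) * bordered K (cols J) (V \<omega>) (std_basis i) (std_basis i) \<partial>M)"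
definition "EH K J = (\<Sum>i\<in>K. \<integral>\<omega>. bordered K (cols J) (V \<omega>) one (std_basis i) * bordered K (cols1 J) (V \<omega>) (std_basis i) (std_basis i) \<partial>M)"

lemma cols_not_UNIV [simp]: "finite J \<Longrightarrow> cols J \<noteq> UNIV" "finite J \<Longrightarrow> cols1 J \<noteq> UNIV"
proof -
  have "infinite (range (Some :: nat \<Rightarrow> nat option))"
    by (simp add: finite_image_iff)
  then have "infinite (UNIV :: nat option set)"
    by (rule infinite_super[rotated]) simp
  then show "finite J \<Longrightarrow> cols J \<noteq> UNIV" "finite J \<Longrightarrow> cols1 J \<noteq> UNIV"
    by (metis finite_imageI finite_insert)+
qed

lemma gram_cols_insert:
  assumes "finite J" "j \<notin> J"
  shows "gram K (cols (insert j J)) (V \<omega>) (V \<omega>) = bordered K (cols J) (V \<omega>) (V \<omega> (Some j)) (V \<omega> (Some j))"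
    and "gram K (cols1 (insert j J)) (V \<omega>) (V \<omega>) = bordered K (cols1 J) (V \<omega>) (V \<omega> (Some j)) (V \<omega> (Some j))"
    and "gram K (cols1 J) (V \<omega>) (V \<omega>) = bordered K (cols J) (V \<omega>) one one"
    and "gram K (cols (insert j J)) ((V \<omega>)(Some j := one)) (V \<omega>) = bordered K (cols J) (V \<omega>) one (V \<omega> (Some j))"
proof -
  have 1: "cols (insert j J) = insert (Some j) (cols J)" "cols1 (insert j J) = insert (Some j) (cols1 J)"
    by auto
  show "gram K (cols (insert j J)) (V \<omega>) (V \<omega>) = bordered K (cols J) (V \<omega>) (V \<omega> (Some j)) (V \<omega> (Some j))"
    unfolding 1 using assms by (intro gram_bordered) auto
  show "gram K (cols1 (insert j J)) (V \<omega>) (V \<omega>) = bordered K (cols1 J) (V \<omega>) (V \<omega> (Some j)) (V \<omega> (Some j))"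
    unfolding 1(2) using assms by (intro gram_bordered) auto
  show "gram K (cols1 J) (V \<omega>) (V \<omega>) = bordered K (cols J) (V \<omega>) one one"
    using assms by (intro gram_bordered) auto
  show "gram K (cols (insert j J)) ((V \<omega>)(Some j := one)) (V \<omega>) = bordered K (cols J) (V \<omega>) one (V \<omega> (Some j))"
    unfolding 1 using assms by (intro gram_bordered) auto
qed

lemma dominated_cols:
  "finite J \<Longrightarrow> dominated K J (\<lambda>y. gram K (cols J) (column y) (column y))"
  "finite J \<Longrightarrow> dominated K J (\<lambda>y. gram K (cols1 J) (column y) (column y))"
  "finite J \<Longrightarrow> dominated K J (\<lambda>y. bordered K (cols J) (column y) x x')"
  "finite J \<Longrightarrow> dominated K J (\<lambda>y. bordered K (cols1 J) (column y) x x')"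
  "finite J \<Longrightarrow> dominated K J (\<lambda>y. gram K (cols J) ((column y)(b := x)) (column y))"
  by (intro dominated_gram_column dominated_bordered dominated_gram_one; auto)+

lemmas int_dominated = integrable_dominated[OF _ dominated_cols(1) dominated_cols(1)] integrable_dominated[OF _ dominated_cols(1) dominated_cols(2)]
  integrable_dominated[OF _ dominated_cols(2) dominated_cols(2)] integrable_dominated[OF _ dominated_cols(3) dominated_cols(3)]
  integrable_dominated[OF _ dominated_cols(3) dominated_cols(4)]

text \<open>The all-ones vector is the sum of the basis vectors.\<close>

lemma rowsum_bordered:
  assumes "finite K" "finite J" "J \<noteq> UNIV"
  shows "(\<Sum>k\<in>K. bordered K J f (std_basis i) (std_basis k)) = bordered K J f one (std_basis i)"
    and "(\<Sum>i\<in>K. bordered K J f one (std_basis i)) = bordered K J f one one"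
  using bordered_units[OF assms(1), of J f one] bordered_sym[OF assms(2,3)] by (metis (no_types, lifting) mult_1 sum.cong)+

text \<open>The all-ones vector is the member \<open>None\<close> of the family, so all row sums of
  the second form vanish.\<close>

lemma bordered_one_cols1:
  assumes "finite J" shows "bordered K (cols1 J) (V \<omega>) one x = 0"
  using bordered_orth[of "cols1 J" None K "V \<omega>" x] assms by simp

lemma bordered_quadratic:
  assumes "finite K" "finite J" "J \<noteq> UNIV"
  shows "bordered K J f (V \<omega> (Some j)) (V \<omega> (Some j)) =
    (\<Sum>i\<in>K. \<Sum>k\<in>K. X i j \<omega> * X k j \<omega> * bordered K J f (std_basis i) (std_basis k))"
  by (subst bordered_units2[OF assms]) simp

text \<open>The left side is the trace of \<open>Q R\<close>; by \<open>bordered_contract\<close>,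
  \<open>Q R\<close> is a multiple of \<open>R\<close>.\<close>

lemma sum_bordered_bordered:
  assumes K: "finite K" and J: "finite J" "J \<subseteq> J'" "finite J'" "J' \<noteq> UNIV"
  shows "(\<Sum>i\<in>K. \<Sum>k\<in>K. bordered K J f (std_basis i) (std_basis k) * bordered K J' f (std_basis i) (std_basis k))
    = gram K J f f * ((real (card K) - real (card J')) * gram K J' f f)"
proof -
  have "(\<Sum>i\<in>K. \<Sum>k\<in>K. bordered K J f (std_basis i) (std_basis k) * bordered K J' f (std_basis i) (std_basis k))
    = (\<Sum>i\<in>K. \<Sum>k\<in>K. bordered K J f (std_basis i) (std_basis k) * bordered K J' f (std_basis k) (std_basis i))"
    by (subst (2) bordered_sym[OF J(3,4)]) simp
  also have "\<dots> = (\<Sum>i\<in>K. gram K J f f * bordered K J' f (std_basis i) (std_basis i))"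
    by (simp add: bordered_contract[OF K J])
  finally show ?thesis
    by (simp add: sum_distrib_left[symmetric] bordered_trace[OF K J(3)])
qed

lemma card_cols [simp]: "finite J \<Longrightarrow> card (cols J) = card J" "finite J \<Longrightarrow> card (cols1 J) = Suc (card J)"
  by (simp_all add: card_image card_insert_if image_iff)

text \<open>Column \<open>j\<close> is averaged first. The factor \<open>2 * d + 4\<close> collects
  two trace products and four cross pairs; \<open>d * (d + 2)\<close> is the squared trace plus
  twice the trace of the square. The \<open>cum4\<close> term sums over deleted rows.\<close>

lemma EA_insert:
  assumes K: "finite K" and J: "finite J" "j \<notin> J"
  defines "d \<equiv> real (card K) - real (card J)"
  shows "EA K (insert j J) = m 1 ^ 4 * EC K J + m 1 ^ 2 * cum2 * (2 * d + 4) * EB K J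
    + cum2 ^ 2 * (d * (d + 2)) * EA K J + cum4 * (\<Sum>i\<in>K. EA (K - {i}) J) + 4 * m 1 * cum3 * ED K J"
proof -
  let ?Q = "\<lambda>i k y. bordered K (cols J) (column y) (std_basis i) (std_basis k)"
  have oJ: "finite (cols J)" "cols J \<noteq> UNIV" using J by auto
  note sym = bordered_sym[OF oJ]
  have "EA K (insert j J) = (\<integral>\<omega>. (\<Sum>i\<in>K. \<Sum>k\<in>K. \<Sum>r\<in>K. \<Sum>s\<in>K. mom4 i k r s * (?Q i k (Y \<omega>) * ?Q r s (Y \<omega>))) \<partial>M)"
    unfolding EA_def gram_cols_insert[OF J] bordered_quadratic[OF K oJ]
    by (rule integral_quartic[OF K J(2)]) (rule dominated_cols J)+
  also have "\<dots> = (\<integral>\<omega>. m 1 ^ 4 * (gram K (cols1 J) (V \<omega>) (V \<omega>) * gram K (cols1 J) (V \<omega>) (V \<omega>))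
    + m 1 ^ 2 * cum2 * (2 * d + 4) * (gram K (cols J) (V \<omega>) (V \<omega>) * gram K (cols1 J) (V \<omega>) (V \<omega>))
    + cum2 ^ 2 * (d * (d + 2)) * (gram K (cols J) (V \<omega>) (V \<omega>) * gram K (cols J) (V \<omega>) (V \<omega>))
    + cum4 * (\<Sum>i\<in>K. gram (K - {i}) (cols J) (V \<omega>) (V \<omega>) * gram (K - {i}) (cols J) (V \<omega>) (V \<omega>))
    + 4 * m 1 * cum3 * (\<Sum>i\<in>K. bordered K (cols J) (V \<omega>) one (std_basis i) * bordered K (cols J) (V \<omega>) (std_basis i) (std_basis i)) \<partial>M)"
  proof (intro Bochner_Integration.integral_cong refl)
    fix \<omega>
    have tr: "(\<Sum>i\<in>K. ?Q i i (Y \<omega>)) = d * gram K (cols J) (V \<omega>) (V \<omega>)"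
      using J by (simp add: bordered_trace[OF K oJ(1)] d_def)
    have sq: "(\<Sum>i\<in>K. bordered K (cols J) (V \<omega>) one (std_basis i) * bordered K (cols J) (V \<omega>) one (std_basis i))
        = gram K (cols J) (V \<omega>) (V \<omega>) * gram K (cols1 J) (V \<omega>) (V \<omega>)"
      unfolding gram_cols_insert(3)[OF J] bordered_contract[OF K oJ(1) subset_refl oJ, symmetric] by (simp add: sym)
    have sq2: "(\<Sum>i\<in>K. \<Sum>k\<in>K. ?Q i k (Y \<omega>) * ?Q i k (Y \<omega>))
        = d * (gram K (cols J) (V \<omega>) (V \<omega>) * gram K (cols J) (V \<omega>) (V \<omega>))"
      using J by (simp add: sum_bordered_bordered[OF K oJ(1) subset_refl oJ] d_def)
    have diag: "(\<Sum>i\<in>K. ?Q i i (Y \<omega>) * ?Q i i (Y \<omega>))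
        = (\<Sum>i\<in>K. gram (K - {i}) (cols J) (V \<omega>) (V \<omega>) * gram (K - {i}) (cols J) (V \<omega>) (V \<omega>))"
      by (intro sum.cong refl) (simp add: bordered_std_basis_std_basis[OF K _ oJ])
    show "(\<Sum>i\<in>K. \<Sum>k\<in>K. \<Sum>r\<in>K. \<Sum>s\<in>K. mom4 i k r s * (?Q i k (Y \<omega>) * ?Q r s (Y \<omega>)))
      = m 1 ^ 4 * (gram K (cols1 J) (V \<omega>) (V \<omega>) * gram K (cols1 J) (V \<omega>) (V \<omega>))
    + m 1 ^ 2 * cum2 * (2 * d + 4) * (gram K (cols J) (V \<omega>) (V \<omega>) * gram K (cols1 J) (V \<omega>) (V \<omega>))
    + cum2 ^ 2 * (d * (d + 2)) * (gram K (cols J) (V \<omega>) (V \<omega>) * gram K (cols J) (V \<omega>) (V \<omega>))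
    + cum4 * (\<Sum>i\<in>K. gram (K - {i}) (cols J) (V \<omega>) (V \<omega>) * gram (K - {i}) (cols J) (V \<omega>) (V \<omega>))
    + 4 * m 1 * cum3 * (\<Sum>i\<in>K. bordered K (cols J) (V \<omega>) one (std_basis i) * bordered K (cols J) (V \<omega>) (std_basis i) (std_basis i))"
      unfolding contract4[OF K, of "\<lambda>i k. ?Q i k (Y \<omega>)" "\<lambda>i k. ?Q i k (Y \<omega>)", OF sym sym]
        rowsum_bordered[OF K oJ] gram_cols_insert(3)[OF J, symmetric] tr sq sq2 diag
      by (simp add: algebra_simps)
  qed
  also have "\<dots> = m 1 ^ 4 * EC K J + m 1 ^ 2 * cum2 * (2 * d + 4) * EB K J
    + cum2 ^ 2 * (d * (d + 2)) * EA K J + cum4 * (\<Sum>i\<in>K. EA (K - {i}) J) + 4 * m 1 * cum3 * ED K J"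
    unfolding EA_def EB_def EC_def ED_def
    using K J by (simp add: int_dominated Bochner_Integration.integral_sum Bochner_Integration.integral_add)
  finally show ?thesis .
qed

text \<open>Since the row sums of \<open>R\<close> vanish, only the terms with the trace or the
  diagonal of \<open>R\<close> keep a factor \<open>m 1\<close>. The trace of \<open>R\<close>
  brings \<open>d - 1\<close>, as the family has one more member.\<close>

lemma EB_insert:
  assumes K: "finite K" and J: "finite J" "j \<notin> J"
  defines "d \<equiv> real (card K) - real (card J)"
  shows "EB K (insert j J) = m 1 ^ 2 * cum2 * (d - 1) * EC K J
    + cum2 ^ 2 * ((d - 1) * (d + 2)) * EB K J + cum4 * (\<Sum>i\<in>K. EB (K - {i}) J) + 2 * m 1 * cum3 * EH K J"
proof -
  let ?Q = "\<lambda>i k y. bordered K (cols J) (column y) (std_basis i) (std_basis k)"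
  let ?R = "\<lambda>i k y. bordered K (cols1 J) (column y) (std_basis i) (std_basis k)"
  have oJ: "finite (cols J)" "cols J \<noteq> UNIV" using J by auto
  have nJ: "finite (cols1 J)" "cols1 J \<noteq> UNIV" using J by auto
  note symQ = bordered_sym[OF oJ] and symR = bordered_sym[OF nJ]
  have "EB K (insert j J) = (\<integral>\<omega>. (\<Sum>i\<in>K. \<Sum>k\<in>K. \<Sum>r\<in>K. \<Sum>s\<in>K. mom4 i k r s * (?Q i k (Y \<omega>) * ?R r s (Y \<omega>))) \<partial>M)"
    unfolding EB_def gram_cols_insert[OF J] bordered_quadratic[OF K oJ] bordered_quadratic[OF K nJ]
    by (rule integral_quartic[OF K J(2)]) (rule dominated_cols J)+
  also have "\<dots> = (\<integral>\<omega>. m 1 ^ 2 * cum2 * (d - 1) * (gram K (cols1 J) (V \<omega>) (V \<omega>) * gram K (cols1 J) (V \<omega>) (V \<omega>))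
    + cum2 ^ 2 * ((d - 1) * (d + 2)) * (gram K (cols J) (V \<omega>) (V \<omega>) * gram K (cols1 J) (V \<omega>) (V \<omega>))
    + cum4 * (\<Sum>i\<in>K. gram (K - {i}) (cols J) (V \<omega>) (V \<omega>) * gram (K - {i}) (cols1 J) (V \<omega>) (V \<omega>))
    + 2 * m 1 * cum3 * (\<Sum>i\<in>K. bordered K (cols J) (V \<omega>) one (std_basis i) * bordered K (cols1 J) (V \<omega>) (std_basis i) (std_basis i)) \<partial>M)"
  proof (intro Bochner_Integration.integral_cong refl)
    fix \<omega>
    have trQ: "(\<Sum>i\<in>K. ?Q i i (Y \<omega>)) = d * gram K (cols J) (V \<omega>) (V \<omega>)"
      using J by (simp add: bordered_trace[OF K oJ(1)] d_def)
    have trR: "(\<Sum>i\<in>K. ?R i i (Y \<omega>)) = (d - 1) * gram K (cols1 J) (V \<omega>) (V \<omega>)"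
      using J by (simp add: bordered_trace[OF K nJ(1)] d_def)
    have QR: "(\<Sum>i\<in>K. \<Sum>k\<in>K. ?Q i k (Y \<omega>) * ?R i k (Y \<omega>))
        = gram K (cols J) (V \<omega>) (V \<omega>) * ((d - 1) * gram K (cols1 J) (V \<omega>) (V \<omega>))"
      using J by (simp add: sum_bordered_bordered[OF K oJ(1) _ nJ] subset_insertI d_def)
    have diag: "(\<Sum>i\<in>K. ?Q i i (Y \<omega>) * ?R i i (Y \<omega>))
        = (\<Sum>i\<in>K. gram (K - {i}) (cols J) (V \<omega>) (V \<omega>) * gram (K - {i}) (cols1 J) (V \<omega>) (V \<omega>))"
      by (intro sum.cong refl) (simp only: bordered_std_basis_std_basis[OF K _ oJ] bordered_std_basis_std_basis[OF K _ nJ])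
    show "(\<Sum>i\<in>K. \<Sum>k\<in>K. \<Sum>r\<in>K. \<Sum>s\<in>K. mom4 i k r s * (?Q i k (Y \<omega>) * ?R r s (Y \<omega>)))
      = m 1 ^ 2 * cum2 * (d - 1) * (gram K (cols1 J) (V \<omega>) (V \<omega>) * gram K (cols1 J) (V \<omega>) (V \<omega>))
    + cum2 ^ 2 * ((d - 1) * (d + 2)) * (gram K (cols J) (V \<omega>) (V \<omega>) * gram K (cols1 J) (V \<omega>) (V \<omega>))
    + cum4 * (\<Sum>i\<in>K. gram (K - {i}) (cols J) (V \<omega>) (V \<omega>) * gram (K - {i}) (cols1 J) (V \<omega>) (V \<omega>))
    + 2 * m 1 * cum3 * (\<Sum>i\<in>K. bordered K (cols J) (V \<omega>) one (std_basis i) * bordered K (cols1 J) (V \<omega>) (std_basis i) (std_basis i))"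
      unfolding contract4[OF K, of "\<lambda>i k. ?Q i k (Y \<omega>)" "\<lambda>i k. ?R i k (Y \<omega>)", OF symQ symR]
        rowsum_bordered[OF K oJ] rowsum_bordered[OF K nJ] bordered_one_cols1[OF J(1)]
        gram_cols_insert(3)[OF J, symmetric] trQ trR QR diag
      by (simp add: algebra_simps)
  qed
  also have "\<dots> = m 1 ^ 2 * cum2 * (d - 1) * EC K J
    + cum2 ^ 2 * ((d - 1) * (d + 2)) * EB K J + cum4 * (\<Sum>i\<in>K. EB (K - {i}) J) + 2 * m 1 * cum3 * EH K J"
    unfolding EB_def EC_def EH_def
    using K J by (simp add: int_dominated Bochner_Integration.integral_sum Bochner_Integration.integral_add)
  finally show ?thesis .
qed

text \<open>Both forms annihilate the all-ones vector, so \<open>m 1\<close> drops out and the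
  recurrence closes on itself; \<open>(d - 1) * (d + 1)\<close> is
  \<open>(d - 1)^2 + 2 (d - 1)\<close>.\<close>

lemma EC_insert:
  assumes K: "finite K" and J: "finite J" "j \<notin> J"
  defines "d \<equiv> real (card K) - real (card J)"
  shows "EC K (insert j J) = cum2 ^ 2 * ((d - 1) * (d + 1)) * EC K J + cum4 * (\<Sum>i\<in>K. EC (K - {i}) J)"
proof -
  let ?R = "\<lambda>i k y. bordered K (cols1 J) (column y) (std_basis i) (std_basis k)"
  have nJ: "finite (cols1 J)" "cols1 J \<noteq> UNIV" using J by auto
  note symR = bordered_sym[OF nJ]
  have "EC K (insert j J) = (\<integral>\<omega>. (\<Sum>i\<in>K. \<Sum>k\<in>K. \<Sum>r\<in>K. \<Sum>s\<in>K. mom4 i k r s * (?R i k (Y \<omega>) * ?R r s (Y \<omega>))) \<partial>M)"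
    unfolding EC_def gram_cols_insert[OF J] bordered_quadratic[OF K nJ]
    by (rule integral_quartic[OF K J(2)]) (rule dominated_cols J)+
  also have "\<dots> = (\<integral>\<omega>. cum2 ^ 2 * ((d - 1) * (d + 1)) * (gram K (cols1 J) (V \<omega>) (V \<omega>) * gram K (cols1 J) (V \<omega>) (V \<omega>))
    + cum4 * (\<Sum>i\<in>K. gram (K - {i}) (cols1 J) (V \<omega>) (V \<omega>) * gram (K - {i}) (cols1 J) (V \<omega>) (V \<omega>)) \<partial>M)"
  proof (intro Bochner_Integration.integral_cong refl)
    fix \<omega>
    have trR: "(\<Sum>i\<in>K. ?R i i (Y \<omega>)) = (d - 1) * gram K (cols1 J) (V \<omega>) (V \<omega>)"
      using J by (simp add: bordered_trace[OF K nJ(1)] d_def)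
    have RR: "(\<Sum>i\<in>K. \<Sum>k\<in>K. ?R i k (Y \<omega>) * ?R i k (Y \<omega>))
        = gram K (cols1 J) (V \<omega>) (V \<omega>) * ((d - 1) * gram K (cols1 J) (V \<omega>) (V \<omega>))"
      using J by (simp add: sum_bordered_bordered[OF K nJ(1) subset_refl nJ] d_def)
    have diag: "(\<Sum>i\<in>K. ?R i i (Y \<omega>) * ?R i i (Y \<omega>))
        = (\<Sum>i\<in>K. gram (K - {i}) (cols1 J) (V \<omega>) (V \<omega>) * gram (K - {i}) (cols1 J) (V \<omega>) (V \<omega>))"
      by (intro sum.cong refl) (simp only: bordered_std_basis_std_basis[OF K _ nJ])
    show "(\<Sum>i\<in>K. \<Sum>k\<in>K. \<Sum>r\<in>K. \<Sum>s\<in>K. mom4 i k r s * (?R i k (Y \<omega>) * ?R r s (Y \<omega>)))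
      = cum2 ^ 2 * ((d - 1) * (d + 1)) * (gram K (cols1 J) (V \<omega>) (V \<omega>) * gram K (cols1 J) (V \<omega>) (V \<omega>))
    + cum4 * (\<Sum>i\<in>K. gram (K - {i}) (cols1 J) (V \<omega>) (V \<omega>) * gram (K - {i}) (cols1 J) (V \<omega>) (V \<omega>))"
      unfolding contract4[OF K, of "\<lambda>i k. ?R i k (Y \<omega>)" "\<lambda>i k. ?R i k (Y \<omega>)", OF symR symR]
        rowsum_bordered[OF K nJ] bordered_one_cols1[OF J(1)] trR RR diag
      by (simp add: algebra_simps)
  qed
  also have "\<dots> = cum2 ^ 2 * ((d - 1) * (d + 1)) * EC K J + cum4 * (\<Sum>i\<in>K. EC (K - {i}) J)"
    unfolding EC_def
    using K J by (simp add: int_dominated Bochner_Integration.integral_sum Bochner_Integration.integral_add)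
  finally show ?thesis .
qed

text \<open>Auxiliary expectations with column \<open>b\<close> overwritten on one side of one
  determinant; they arise when \<open>(Q e)_i\<close> is expanded in row \<open>i\<close>.\<close>

definition "ES K J b = (\<integral>\<omega>. gram K (cols J) ((V \<omega>)(Some b := one)) (V \<omega>) * gram K (cols J) (V \<omega>) (V \<omega>) \<partial>M)"
definition "EZ K J b = (\<integral>\<omega>. gram K (cols J) ((V \<omega>)(Some b := one)) (V \<omega>) * gram K (cols1 J) (V \<omega>) (V \<omega>) \<partial>M)"

text \<open>The overwritten column remains on one side of the first factor and on both sides of the
  second, so third moments suffice to eliminate it.\<close>

lemma ES_insert:
  assumes K: "finite K" and J: "finite J" "j \<notin> J"
  defines "d \<equiv> real (card K) - real (card J)"
  shows "ES K (insert j J) j = m 1 ^ 3 * EC K J + m 1 * cum2 * (d + 2) * EB K J + cum3 * ED K J"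
proof -
  let ?W = "\<lambda>i y. bordered K (cols J) (column y) one (std_basis i)"
  let ?Q = "\<lambda>i k y. bordered K (cols J) (column y) (std_basis i) (std_basis k)"
  have oJ: "finite (cols J)" "cols J \<noteq> UNIV" using J by auto
  note sym = bordered_sym[OF oJ]
  have lin: "bordered K (cols J) (V \<omega>) one (V \<omega> (Some j)) = (\<Sum>i\<in>K. X i j \<omega> * ?W i (Y \<omega>))" for \<omega>
    by (subst sym, subst bordered_units[OF K]) (simp add: sym[of K "V \<omega>" "std_basis _"])
  have "ES K (insert j J) j = (\<integral>\<omega>. (\<Sum>i\<in>K. \<Sum>r\<in>K. \<Sum>s\<in>K. mom3 i r s * (?W i (Y \<omega>) * ?Q r s (Y \<omega>))) \<partial>M)"
    unfolding ES_def gram_cols_insert[OF J] bordered_quadratic[OF K oJ] lin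
    by (rule integral_cubic[OF K J(2)]) (rule dominated_cols J)+
  also have "\<dots> = (\<integral>\<omega>. m 1 ^ 3 * (gram K (cols1 J) (V \<omega>) (V \<omega>) * gram K (cols1 J) (V \<omega>) (V \<omega>))
    + m 1 * cum2 * (d + 2) * (gram K (cols J) (V \<omega>) (V \<omega>) * gram K (cols1 J) (V \<omega>) (V \<omega>))
    + cum3 * (\<Sum>i\<in>K. bordered K (cols J) (V \<omega>) one (std_basis i) * bordered K (cols J) (V \<omega>) (std_basis i) (std_basis i)) \<partial>M)"
  proof (intro Bochner_Integration.integral_cong refl)
    fix \<omega>
    have tr: "(\<Sum>i\<in>K. ?Q i i (Y \<omega>)) = d * gram K (cols J) (V \<omega>) (V \<omega>)"
      using J by (simp add: bordered_trace[OF K oJ(1)] d_def)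
    have sq: "(\<Sum>i\<in>K. bordered K (cols J) (V \<omega>) one (std_basis i) * bordered K (cols J) (V \<omega>) one (std_basis i))
        = gram K (cols J) (V \<omega>) (V \<omega>) * gram K (cols1 J) (V \<omega>) (V \<omega>)"
      unfolding gram_cols_insert(3)[OF J] bordered_contract[OF K oJ(1) subset_refl oJ, symmetric] by (simp add: sym)
    show "(\<Sum>i\<in>K. \<Sum>r\<in>K. \<Sum>s\<in>K. mom3 i r s * (?W i (Y \<omega>) * ?Q r s (Y \<omega>)))
      = m 1 ^ 3 * (gram K (cols1 J) (V \<omega>) (V \<omega>) * gram K (cols1 J) (V \<omega>) (V \<omega>))
    + m 1 * cum2 * (d + 2) * (gram K (cols J) (V \<omega>) (V \<omega>) * gram K (cols1 J) (V \<omega>) (V \<omega>))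
    + cum3 * (\<Sum>i\<in>K. bordered K (cols J) (V \<omega>) one (std_basis i) * bordered K (cols J) (V \<omega>) (std_basis i) (std_basis i))"
      unfolding contract3[OF K, of "\<lambda>i k. ?Q i k (Y \<omega>)" "\<lambda>i. ?W i (Y \<omega>)", OF sym]
        rowsum_bordered[OF K oJ] gram_cols_insert(3)[OF J, symmetric] tr sq
      by (simp add: algebra_simps)
  qed
  also have "\<dots> = m 1 ^ 3 * EC K J + m 1 * cum2 * (d + 2) * EB K J + cum3 * ED K J"
    unfolding EB_def EC_def ED_def
    using K J by (simp add: int_dominated Bochner_Integration.integral_sum Bochner_Integration.integral_add)
  finally show ?thesis .
qed

text \<open>As for \<open>ES_insert\<close>, but the second form annihilates the all-ones vector,
  leaving only its trace and its diagonal.\<close>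

lemma EZ_insert:
  assumes K: "finite K" and J: "finite J" "j \<notin> J"
  defines "d \<equiv> real (card K) - real (card J)"
  shows "EZ K (insert j J) j = m 1 * cum2 * (d - 1) * EC K J + cum3 * EH K J"
proof -
  let ?W = "\<lambda>i y. bordered K (cols J) (column y) one (std_basis i)"
  let ?R = "\<lambda>i k y. bordered K (cols1 J) (column y) (std_basis i) (std_basis k)"
  have oJ: "finite (cols J)" "cols J \<noteq> UNIV" using J by auto
  have nJ: "finite (cols1 J)" "cols1 J \<noteq> UNIV" using J by auto
  note sym = bordered_sym[OF oJ] and symR = bordered_sym[OF nJ]
  have lin: "bordered K (cols J) (V \<omega>) one (V \<omega> (Some j)) = (\<Sum>i\<in>K. X i j \<omega> * ?W i (Y \<omega>))" for \<omega>
    by (subst sym, subst bordered_units[OF K]) (simp add: sym[of K "V \<omega>" "std_basis _"])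
  have "EZ K (insert j J) j = (\<integral>\<omega>. (\<Sum>i\<in>K. \<Sum>r\<in>K. \<Sum>s\<in>K. mom3 i r s * (?W i (Y \<omega>) * ?R r s (Y \<omega>))) \<partial>M)"
    unfolding EZ_def gram_cols_insert[OF J] bordered_quadratic[OF K nJ] lin
    by (rule integral_cubic[OF K J(2)]) (rule dominated_cols J)+
  also have "\<dots> = (\<integral>\<omega>. m 1 * cum2 * (d - 1) * (gram K (cols1 J) (V \<omega>) (V \<omega>) * gram K (cols1 J) (V \<omega>) (V \<omega>))
    + cum3 * (\<Sum>i\<in>K. bordered K (cols J) (V \<omega>) one (std_basis i) * bordered K (cols1 J) (V \<omega>) (std_basis i) (std_basis i)) \<partial>M)"
  proof (intro Bochner_Integration.integral_cong refl)
    fix \<omega>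
    have tr: "(\<Sum>i\<in>K. ?R i i (Y \<omega>)) = (d - 1) * gram K (cols1 J) (V \<omega>) (V \<omega>)"
      using J by (simp add: bordered_trace[OF K nJ(1)] d_def)
    show "(\<Sum>i\<in>K. \<Sum>r\<in>K. \<Sum>s\<in>K. mom3 i r s * (?W i (Y \<omega>) * ?R r s (Y \<omega>)))
      = m 1 * cum2 * (d - 1) * (gram K (cols1 J) (V \<omega>) (V \<omega>) * gram K (cols1 J) (V \<omega>) (V \<omega>))
    + cum3 * (\<Sum>i\<in>K. bordered K (cols J) (V \<omega>) one (std_basis i) * bordered K (cols1 J) (V \<omega>) (std_basis i) (std_basis i))"
      unfolding contract3[OF K, of "\<lambda>i k. ?R i k (Y \<omega>)" "\<lambda>i. ?W i (Y \<omega>)", OF symR]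
        rowsum_bordered[OF K oJ] rowsum_bordered[OF K nJ] bordered_one_cols1[OF J(1)]
        gram_cols_insert(3)[OF J, symmetric] tr
      by (simp add: algebra_simps)
  qed
  also have "\<dots> = m 1 * cum2 * (d - 1) * EC K J + cum3 * EH K J"
    unfolding EC_def EH_def
    using K J by (simp add: int_dominated Bochner_Integration.integral_sum Bochner_Integration.integral_add)
  finally show ?thesis .
qed

text \<open>Row \<open>i\<close> enters \<open>(Q e)_i\<close> affinely and is independent of all
  factors on \<open>K - {i}\<close>, so averaging replaces each of its entries by
  \<open>m 1\<close>.\<close>

lemma expand_row:
  assumes K: "finite K" "i \<in> K" and J: "finite J"
    and G: "dominated (K - {i}) J G"
  shows "(\<integral>\<omega>. bordered K (cols J) (V \<omega>) one (std_basis i) * G (Y \<omega>) \<partial>M)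
    = (\<integral>\<omega>. gram (K - {i}) (cols J) (V \<omega>) (V \<omega>) * G (Y \<omega>) \<partial>M)
      - m 1 * (\<Sum>b\<in>J. \<integral>\<omega>. gram (K - {i}) (cols J) ((V \<omega>)(Some b := one)) (V \<omega>) * G (Y \<omega>) \<partial>M)"
proof -
  have oJ: "finite (cols J)" "cols J \<noteq> UNIV" using J by auto
  let ?S = "\<lambda>b y. gram (K - {i}) (cols J) ((column y)(Some b := one)) (column y)"
  have S: "dominated (K - {i}) J (?S b)" for b by (rule dominated_cols[OF J])
  have fin: "finite (K - {i})" "i \<notin> K - {i}" using K by auto
  have "bordered K (cols J) (V \<omega>) one (std_basis i) * G (Y \<omega>)
     = gram (K - {i}) (cols J) (V \<omega>) (V \<omega>) * G (Y \<omega>) - (\<Sum>b\<in>J. X i b \<omega> * (?S b (Y \<omega>) * G (Y \<omega>)))" for \<omega>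
    by (simp add: bordered_const_one_std_basis[OF K oJ] sum.reindex left_diff_distrib sum_distrib_right mult.assoc)
  then show ?thesis
    by (simp add: integral_linear[OF fin S G] integrable_dominated[OF fin(1) dominated_cols(1)[OF J] G] sum_distrib_left
        Bochner_Integration.integral_sum Bochner_Integration.integral_diff)
qed

text \<open>The diagonal entry \<open>Q_ii\<close> is a Gram determinant on \<open>K - {i}\<close>,
  so it can serve as the factor \<open>G\<close> in \<open>expand_row\<close>.\<close>

lemma ED_rec:
  assumes K: "finite K" and J: "finite J"
  shows "ED K J = (\<Sum>i\<in>K. EA (K - {i}) J - m 1 * (\<Sum>b\<in>J. ES (K - {i}) J b))"
  unfolding ED_def
proof (intro sum.cong refl)
  fix i assume i: "i \<in> K"
  have oJ: "finite (cols J)" "cols J \<noteq> UNIV" using J by auto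
  show "(\<integral>\<omega>. bordered K (cols J) (V \<omega>) one (std_basis i) * bordered K (cols J) (V \<omega>) (std_basis i) (std_basis i) \<partial>M)
      = EA (K - {i}) J - m 1 * (\<Sum>b\<in>J. ES (K - {i}) J b)"
    unfolding EA_def ES_def bordered_std_basis_std_basis[OF K i oJ]
    by (rule expand_row[OF K i J dominated_cols(1)[OF J]])
qed

lemma EH_rec:
  assumes K: "finite K" and J: "finite J"
  shows "EH K J = (\<Sum>i\<in>K. EB (K - {i}) J - m 1 * (\<Sum>b\<in>J. EZ (K - {i}) J b))"
  unfolding EH_def
proof (intro sum.cong refl)
  fix i assume i: "i \<in> K"
  have nJ: "finite (cols1 J)" "cols1 J \<noteq> UNIV" using J by auto
  show "(\<integral>\<omega>. bordered K (cols J) (V \<omega>) one (std_basis i) * bordered K (cols1 J) (V \<omega>) (std_basis i) (std_basis i) \<partial>M)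
      = EB (K - {i}) J - m 1 * (\<Sum>b\<in>J. EZ (K - {i}) J b)"
    unfolding EB_def EZ_def bordered_std_basis_std_basis[OF K i nJ]
    by (rule expand_row[OF K i J dominated_cols(2)[OF J]])
qed

end

section \<open>Solution of the recurrences\<close>

context iid_array
begin

interpretation gf: gf_params "m 1" cum2 cum3 cum4 .

text \<open>Undoes the normalisation, with \<open>q = n - p - s\<close>. The shift \<open>s\<close>
  marks where the expectation starts to be nonzero in general; the test guards the truncated
  subtraction.\<close>

definition "scaled_coeff s f n p = (if p + s \<le> n then fact n * fact p / fact (n - p - s) * fps_nth (f (n - p - s) :: real fps) p else 0)"

definition "closed_form K J \<longleftrightarrow>
    EA K J = scaled_coeff 0 gf.gA (card K) (card J) \<and> EB K J = scaled_coeff 1 gf.gB (card K) (card J) \<and>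
    EC K J = scaled_coeff 1 gf.gC (card K) (card J) \<and> ED K J = scaled_coeff 1 gf.gD (card K) (card J) \<and>
    EH K J = scaled_coeff 2 gf.gH (card K) (card J)"

lemma EA_empty: "EA K {} = 1" and EB_empty: "EB K {} = real (card K)"
  and EC_empty: "EC K {} = (real (card K))\<^sup>2"
proof -
  have 1: "gram K {} f g = 1" for f g :: "nat option \<Rightarrow> nat \<Rightarrow> real" by (simp add: gram_def)
  have 2: "gram K {None} (V \<omega>) (V \<omega>) = real (card K)" for \<omega>
    using gram_insert[of "{}" None K "V \<omega>" "V \<omega>"] by (simp add: 1 inner_on_def)
  show "EA K {} = 1" "EB K {} = real (card K)" "EC K {} = (real (card K))\<^sup>2"
    by (simp_all add: EA_def EB_def EC_def 1 2 prob_space power2_eq_square)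
qed

section \<open>Arithmetic of the normalising factors\<close>

lemma scaled_coeff_less: "n < p + s \<Longrightarrow> scaled_coeff s f n p = 0"
  by (simp add: scaled_coeff_def)

lemma scaled_coeff_eval: "n = p + q + s \<Longrightarrow> scaled_coeff s f n p = fact n * fact p / fact q * fps_nth (f q) p"
  by (simp add: scaled_coeff_def)

text \<open>The factor \<open>d\<close> or \<open>d - 1\<close> of the recurrences absorbs the
  change from \<open>fact (q + 1)\<close> to \<open>fact q\<close>.\<close>

lemma scaled_coeff_eval_Suc:
  assumes "n = p + q + s + 1"
  shows "(real q + 1) * scaled_coeff s f n p = fact n * fact p / fact q * fps_nth (f (q + 1)) p"
proof -
  have "r * (x / (r * z) * y) = x / z * y" if "r \<noteq> 0" for r x y z :: real
    using that by simp
  moreover have "real q + 1 \<noteq> 0" by linarith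
  moreover have "fact (q + 1) = (real q + 1) * fact q" by simp
  ultimately have "(real q + 1) * (x / fact (q + 1) * y) = x / fact q * y" for x y :: real
    by metis
  then show ?thesis
    using scaled_coeff_eval[of n p "q + 1" s f] assms by simp
qed

text \<open>The \<open>n\<close> choices of a deleted row restore \<open>fact n\<close>.\<close>

lemma scaled_coeff_pred:
  assumes "n = p + q + s + 1"
  shows "real n * scaled_coeff s f (n - 1) p = fact n * fact p / fact q * fps_nth (f q) p"
proof -
  have "real (N + 1) * (fact N * x * y) = fact (N + 1) * x * y" for N and x y :: real by simp
  then show ?thesis
    using scaled_coeff_eval[of "n - 1" p q s f] assms by (simp add: divide_inverse mult.assoc)
qed

text \<open>The choices of an overwritten column restore \<open>fact (Suc p)\<close>.\<close>

lemma scaled_coeff_pred_col: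
  assumes "n = p + q + s"
  shows "real (Suc p) * scaled_coeff s f n p = fact n * fact (Suc p) / fact q * fps_nth (f q) p"
  using scaled_coeff_eval[OF assms, of f] by simp

lemma closed_form_step1:
  assumes K: "finite K" and J: "finite J" "j \<notin> J"
    and cf: "\<And>K'. finite K' \<Longrightarrow> closed_form K' J"
  shows "EA K (insert j J) = scaled_coeff 0 gf.gA (card K) (Suc (card J))"
    and "EB K (insert j J) = scaled_coeff 1 gf.gB (card K) (Suc (card J))"
    and "EC K (insert j J) = scaled_coeff 1 gf.gC (card K) (Suc (card J))"
proof -
  define n p where "n = card K" and "p = card J"
  have cfK: "EA K J = scaled_coeff 0 gf.gA n p" "EB K J = scaled_coeff 1 gf.gB n p" "EC K J = scaled_coeff 1 gf.gC n p"
    "ED K J = scaled_coeff 1 gf.gD n p" "EH K J = scaled_coeff 2 gf.gH n p"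
    using cf[OF K] by (simp_all add: closed_form_def n_def p_def)
  have cfi: "EA (K - {i}) J = scaled_coeff 0 gf.gA (n - 1) p" "EB (K - {i}) J = scaled_coeff 1 gf.gB (n - 1) p"
    "EC (K - {i}) J = scaled_coeff 1 gf.gC (n - 1) p" if "i \<in> K" for i
    using cf[of "K - {i}"] K that by (simp_all add: closed_form_def n_def p_def)
  have sums: "(\<Sum>i\<in>K. EA (K - {i}) J) = n * scaled_coeff 0 gf.gA (n - 1) p"
     "(\<Sum>i\<in>K. EB (K - {i}) J) = n * scaled_coeff 1 gf.gB (n - 1) p"
     "(\<Sum>i\<in>K. EC (K - {i}) J) = n * scaled_coeff 1 gf.gC (n - 1) p"
    by (simp_all add: cfi n_def)
  note A = EA_insert[OF K J, folded n_def p_def, unfolded cfK sums]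
  note B = EB_insert[OF K J, folded n_def p_def, unfolded cfK sums]
  note C = EC_insert[OF K J, folded n_def p_def, unfolded cfK sums]
  show "EA K (insert j J) = scaled_coeff 0 gf.gA (card K) (Suc (card J))"
  proof (cases "Suc p \<le> n")
    case False
    \<comment> \<open>At \<open>n = p\<close> the factor \<open>d\<close> vanishes and the other
      terms are below their thresholds; for \<open>n < p\<close> all terms are. At
      \<open>n = 0\<close>, where \<open>n - 1 = n\<close>, the deletion sum has the factor
      \<open>n\<close>.\<close>
    then consider "n = p" | "n < p" by linarith
    then show ?thesis
      by cases (cases n; simp add: A scaled_coeff_less n_def[symmetric] p_def[symmetric])+
  next
    case True
    then obtain q where q: "n = Suc (p + q)" by (metis add_Suc le_iff_add)
    \<comment> \<open>The normalisation common to all terms; the missing factor \<open>Suc p\<close>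
      of the target comes from the derivative coefficient in \<open>gA_nth\<close>.\<close>
    define co :: real where "co = fact n * fact p / fact q"
    have w: "(real q + 1) * scaled_coeff 0 gf.gA n p = co * fps_nth (gf.gA (q + 1)) p"
      "scaled_coeff 1 gf.gB n p = co * fps_nth (gf.gB q) p"
      "scaled_coeff 1 gf.gC n p = co * fps_nth (gf.gC q) p"
      "scaled_coeff 1 gf.gD n p = co * fps_nth (gf.gD q) p"
      "n * scaled_coeff 0 gf.gA (n - 1) p = co * fps_nth (gf.gA q) p"
      using scaled_coeff_eval_Suc[of n p q 0 gf.gA] scaled_coeff_eval[of n p q 1] scaled_coeff_pred[of n p q 0 gf.gA] by (simp_all add: q co_def del: fact_Suc of_nat_Suc)
    have d: "real n - real p = real q + 1" by (simp add: q)
    have "EA K (insert j J) = m 1 ^ 4 * scaled_coeff 1 gf.gC n p + m 1 ^ 2 * cum2 * (2 * real q + 6) * scaled_coeff 1 gf.gB n p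
      + cum2 ^ 2 * (real q + 3) * ((real q + 1) * scaled_coeff 0 gf.gA n p) + cum4 * (n * scaled_coeff 0 gf.gA (n - 1) p)
      + 4 * m 1 * cum3 * scaled_coeff 1 gf.gD n p"
      unfolding A d by (simp add: algebra_simps)
    also have "\<dots> = co * ((1 + real p) * fps_nth (gf.gA q) (Suc p))"
      unfolding w gf.gA_nth by (simp add: algebra_simps)
    finally show ?thesis unfolding n_def[symmetric] p_def[symmetric] by (simp add: scaled_coeff_def q co_def algebra_simps)
  qed
  show "EB K (insert j J) = scaled_coeff 1 gf.gB (card K) (Suc (card J))"
  proof (cases "Suc (Suc p) \<le> n")
    case False
    \<comment> \<open>The threshold is one higher than for \<open>EA\<close>; at
      \<open>n = Suc p\<close> it is \<open>d - 1\<close> that vanishes.\<close>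
    then consider "n = Suc p" | "n = p" | "n < p" by linarith
    then show ?thesis
      by cases (cases n; simp add: B scaled_coeff_less n_def[symmetric] p_def[symmetric])+
  next
    case True
    then obtain q where q: "n = Suc (Suc (p + q))" by (metis add_Suc le_iff_add)
    define co :: real where "co = fact n * fact p / fact q"
    have w: "(real q + 1) * scaled_coeff 1 gf.gB n p = co * fps_nth (gf.gB (q + 1)) p"
      "(real q + 1) * scaled_coeff 1 gf.gC n p = co * fps_nth (gf.gC (q + 1)) p"
      "scaled_coeff 2 gf.gH n p = co * fps_nth (gf.gH q) p"
      "n * scaled_coeff 1 gf.gB (n - 1) p = co * fps_nth (gf.gB q) p"
      using scaled_coeff_eval_Suc[of n p q 1] scaled_coeff_eval[of n p q 2 gf.gH] scaled_coeff_pred[of n p q 1 gf.gB] by (simp_all add: q co_def del: fact_Suc of_nat_Suc)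
    have d: "real n - real p = real q + 2" by (simp add: q)
    have "EB K (insert j J) = m 1 ^ 2 * cum2 * ((real q + 1) * scaled_coeff 1 gf.gC n p)
      + cum2 ^ 2 * (real q + 4) * ((real q + 1) * scaled_coeff 1 gf.gB n p)
      + cum4 * (n * scaled_coeff 1 gf.gB (n - 1) p) + 2 * m 1 * cum3 * scaled_coeff 2 gf.gH n p"
      unfolding B d by (simp add: algebra_simps)
    also have "\<dots> = co * ((1 + real p) * fps_nth (gf.gB q) (Suc p))"
      unfolding w gf.gB_nth by (simp add: algebra_simps)
    finally show ?thesis unfolding n_def[symmetric] p_def[symmetric] by (simp add: scaled_coeff_def q co_def algebra_simps)
  qed
  show "EC K (insert j J) = scaled_coeff 1 gf.gC (card K) (Suc (card J))"
  proof (cases "Suc (Suc p) \<le> n")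
    case False
    then consider "n = Suc p" | "n = p" | "n < p" by linarith
    then show ?thesis
      by cases (cases n; simp add: C scaled_coeff_less n_def[symmetric] p_def[symmetric])+
  next
    case True
    then obtain q where q: "n = Suc (Suc (p + q))" by (metis add_Suc le_iff_add)
    define co :: real where "co = fact n * fact p / fact q"
    have w: "(real q + 1) * scaled_coeff 1 gf.gC n p = co * fps_nth (gf.gC (q + 1)) p"
      "n * scaled_coeff 1 gf.gC (n - 1) p = co * fps_nth (gf.gC q) p"
      using scaled_coeff_eval_Suc[of n p q 1 gf.gC] scaled_coeff_pred[of n p q 1 gf.gC] by (simp_all add: q co_def del: fact_Suc of_nat_Suc)
    have d: "real n - real p = real q + 2" by (simp add: q)
    have "EC K (insert j J) = cum2 ^ 2 * (real q + 3) * ((real q + 1) * scaled_coeff 1 gf.gC n p)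
      + cum4 * (n * scaled_coeff 1 gf.gC (n - 1) p)"
      unfolding C d by (simp add: algebra_simps)
    also have "\<dots> = co * ((1 + real p) * fps_nth (gf.gC q) (Suc p))"
      unfolding w gf.gC_nth by (simp add: algebra_simps)
    finally show ?thesis unfolding n_def[symmetric] p_def[symmetric] by (simp add: scaled_coeff_def q co_def algebra_simps)
  qed
qed

text \<open>Expanding a row expresses \<open>ED\<close> and \<open>EH\<close> by \<open>EA\<close>
  and \<open>EB\<close> for the same columns and by expectations with one column fewer, so these two
  follow after the first three.\<close>

lemma closed_form_step2:
  assumes K: "finite K" and J: "finite J"
    and A: "\<And>K'. finite K' \<Longrightarrow> EA K' J = scaled_coeff 0 gf.gA (card K') (card J)"
    and B: "\<And>K'. finite K' \<Longrightarrow> EB K' J = scaled_coeff 1 gf.gB (card K') (card J)"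
    and cf: "\<And>K' b. finite K' \<Longrightarrow> b \<in> J \<Longrightarrow> closed_form K' (J - {b})"
  shows "ED K J = scaled_coeff 1 gf.gD (card K) (card J)"
    and "EH K J = scaled_coeff 2 gf.gH (card K) (card J)"
proof -
  define n p where "n = card K" and "p = card J"
  have c: "card (K - {i}) = n - 1" if "i \<in> K" for i using that K by (simp add: n_def)
  have S: "ES (K - {i}) J b = m 1 ^ 3 * scaled_coeff 1 gf.gC (n - 1) (p - 1)
      + m 1 * cum2 * (real (n - 1) - real (p - 1) + 2) * scaled_coeff 1 gf.gB (n - 1) (p - 1)
      + cum3 * scaled_coeff 1 gf.gD (n - 1) (p - 1)"
    and Z: "EZ (K - {i}) J b = m 1 * cum2 * (real (n - 1) - real (p - 1) - 1) * scaled_coeff 1 gf.gC (n - 1) (p - 1)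
      + cum3 * scaled_coeff 2 gf.gH (n - 1) (p - 1)" if "i \<in> K" "b \<in> J" for i b
  proof -
    have J': "finite (J - {b})" "b \<notin> J - {b}" "card (J - {b}) = p - 1" "insert b (J - {b}) = J"
      using J that by (auto simp: p_def)
    have K': "finite (K - {i})" using K by simp
    show "ES (K - {i}) J b = m 1 ^ 3 * scaled_coeff 1 gf.gC (n - 1) (p - 1)
      + m 1 * cum2 * (real (n - 1) - real (p - 1) + 2) * scaled_coeff 1 gf.gB (n - 1) (p - 1)
      + cum3 * scaled_coeff 1 gf.gD (n - 1) (p - 1)"
      using ES_insert[OF K' J'(1,2)] cf[OF K' that(2)] unfolding closed_form_def J'(3,4) c[OF that(1)] by simp
    show "EZ (K - {i}) J b = m 1 * cum2 * (real (n - 1) - real (p - 1) - 1) * scaled_coeff 1 gf.gC (n - 1) (p - 1)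
      + cum3 * scaled_coeff 2 gf.gH (n - 1) (p - 1)"
      using EZ_insert[OF K' J'(1,2)] cf[OF K' that(2)] unfolding closed_form_def J'(3,4) c[OF that(1)] by simp
  qed
  have E: "ED K J = n * (scaled_coeff 0 gf.gA (n - 1) p - m 1 * (p * (m 1 ^ 3 * scaled_coeff 1 gf.gC (n - 1) (p - 1)
      + m 1 * cum2 * (real (n - 1) - real (p - 1) + 2) * scaled_coeff 1 gf.gB (n - 1) (p - 1)
      + cum3 * scaled_coeff 1 gf.gD (n - 1) (p - 1))))"
    unfolding ED_rec[OF K J] using K by (simp add: A S c n_def[symmetric] p_def[symmetric])
  have H: "EH K J = n * (scaled_coeff 1 gf.gB (n - 1) p - m 1 * (p *
      (m 1 * cum2 * (real (n - 1) - real (p - 1) - 1) * scaled_coeff 1 gf.gC (n - 1) (p - 1)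
      + cum3 * scaled_coeff 2 gf.gH (n - 1) (p - 1))))"
    unfolding EH_rec[OF K J] using K by (simp add: B Z c n_def[symmetric] p_def[symmetric])
  have "ED K J = scaled_coeff 1 gf.gD n p"
  proof (cases "Suc p \<le> n")
    case False
    then show ?thesis by (cases n; cases p; simp add: E scaled_coeff_less)
  next
    case True
    then obtain q where q: "n = Suc (p + q)" by (metis add_Suc le_iff_add)
    show ?thesis
    proof (cases p)
      case 0
      then show ?thesis unfolding E by (simp add: scaled_coeff_def q gf.gD_nth del: One_nat_def)
    next
      case (Suc p')
      define co :: real where "co = fact (n - 1) * fact p / fact q"
      have w: "scaled_coeff 0 gf.gA (n - 1) p = co * fps_nth (gf.gA q) (Suc p')"
        "p * scaled_coeff 1 gf.gB (n - 1) (p - 1) = co * fps_nth (gf.gB q) p'"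
        "p * scaled_coeff 1 gf.gC (n - 1) (p - 1) = co * fps_nth (gf.gC q) p'"
        "p * scaled_coeff 1 gf.gD (n - 1) (p - 1) = co * fps_nth (gf.gD q) p'"
        using scaled_coeff_eval[of "n - 1" p q 0 gf.gA] scaled_coeff_pred_col[of "n - 1" p' q 1]
        by (simp_all add: q Suc co_def del: fact_Suc of_nat_Suc)
      have d: "real (n - 1) - real (p - 1) + 2 = real q + 3" by (simp add: q Suc)
      have "ED K J = n * (scaled_coeff 0 gf.gA (n - 1) p - m 1 * (m 1 ^ 3 * (p * scaled_coeff 1 gf.gC (n - 1) (p - 1))
        + m 1 * cum2 * (real q + 3) * (p * scaled_coeff 1 gf.gB (n - 1) (p - 1))
        + cum3 * (p * scaled_coeff 1 gf.gD (n - 1) (p - 1))))"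
        unfolding E d by (simp add: algebra_simps)
      also have "\<dots> = n * co * fps_nth (gf.gD q) (Suc p')"
        unfolding w gf.gD_nth by (simp add: algebra_simps)
      finally show ?thesis by (simp add: scaled_coeff_def q Suc co_def)
    qed
  qed
  then show "ED K J = scaled_coeff 1 gf.gD (card K) (card J)" by (simp add: n_def p_def)
  have "EH K J = scaled_coeff 2 gf.gH n p"
  proof (cases "Suc (Suc p) \<le> n")
    case False
    then show ?thesis
      using H by (cases "n = Suc p"; cases "n = p"; cases p; simp add: scaled_coeff_less)
  next
    case True
    then obtain q where q: "n = Suc (Suc (p + q))" by (metis add_Suc le_iff_add)
    show ?thesis
    proof (cases p)
      case 0
      then show ?thesis unfolding H by (simp add: scaled_coeff_def q gf.gH_nth del: One_nat_def)
    next
      case (Suc p')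
      define co :: real where "co = fact (n - 1) * fact p / fact q"
      have "(real q + 1) * (p * scaled_coeff 1 gf.gC (n - 1) (p - 1)) = p * ((real q + 1) * scaled_coeff 1 gf.gC (n - 1) (p - 1))"
        by simp
      also have "\<dots> = p * (fact (n - 1) * fact (p - 1) / fact q * fps_nth (gf.gC (q + 1)) (p - 1))"
        by (subst scaled_coeff_eval_Suc) (simp_all add: q Suc)
      also have "\<dots> = co * fps_nth (gf.gC (q + 1)) p'"
        by (simp add: Suc co_def)
      finally have wC: "(real q + 1) * (p * scaled_coeff 1 gf.gC (n - 1) (p - 1)) = co * fps_nth (gf.gC (q + 1)) p'" .
      have w: "scaled_coeff 1 gf.gB (n - 1) p = co * fps_nth (gf.gB q) (Suc p')"
        "p * scaled_coeff 2 gf.gH (n - 1) (p - 1) = co * fps_nth (gf.gH q) p'"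
        using scaled_coeff_eval[of "n - 1" p q 1 gf.gB] scaled_coeff_pred_col[of "n - 1" p' q 2 gf.gH]
        by (simp_all add: q Suc co_def del: fact_Suc of_nat_Suc)
      have d: "real (n - 1) - real (p - 1) - 1 = real q + 1" by (simp add: q Suc)
      have "EH K J = n * (scaled_coeff 1 gf.gB (n - 1) p - m 1 * (m 1 * cum2 * ((real q + 1) * (p * scaled_coeff 1 gf.gC (n - 1) (p - 1)))
        + cum3 * (p * scaled_coeff 2 gf.gH (n - 1) (p - 1))))"
        unfolding H d by (simp add: algebra_simps)
      also have "\<dots> = n * co * fps_nth (gf.gH q) (Suc p')"
        unfolding w wC gf.gH_nth by (simp add: algebra_simps)
      finally show ?thesis by (simp add: scaled_coeff_def q Suc co_def)
    qed
  qed
  then show "EH K J = scaled_coeff 2 gf.gH (card K) (card J)" by (simp add: n_def p_def)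
qed

text \<open>Induction on the number of columns, for all row sets at once because the recurrences
  delete rows.\<close>

lemma closed_form:
  assumes "finite K" "finite J"
  shows "closed_form K J"
  using assms
proof (induction "card J" arbitrary: J K)
  case 0
  then have J: "J = {}" by simp
  have A: "EA K' {} = scaled_coeff 0 gf.gA (card K') 0" and B: "EB K' {} = scaled_coeff 1 gf.gB (card K') 0"
    and C: "EC K' {} = scaled_coeff 1 gf.gC (card K') 0" for K'
  proof -
    show "EA K' {} = scaled_coeff 0 gf.gA (card K') 0"
      by (simp add: EA_empty scaled_coeff_eval[of _ 0 "card K'"] del: One_nat_def)
    show "EB K' {} = scaled_coeff 1 gf.gB (card K') 0" "EC K' {} = scaled_coeff 1 gf.gC (card K') 0"
    proof (atomize (full), cases "card K'")
      case 0
      then show "EB K' {} = scaled_coeff 1 gf.gB (card K') 0 \<and> EC K' {} = scaled_coeff 1 gf.gC (card K') 0"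
        by (simp only: EB_empty EC_empty) (simp add: scaled_coeff_less)
    next
      case (Suc q)
      have "scaled_coeff 1 f (Suc q) 0 = (real q + 1) * fps_nth (f q) 0" for f
        using scaled_coeff_eval[of "Suc q" 0 q 1 f] by simp
      then show "EB K' {} = scaled_coeff 1 gf.gB (card K') 0 \<and> EC K' {} = scaled_coeff 1 gf.gC (card K') 0"
        by (simp only: EB_empty EC_empty Suc gf.gf_0) (simp add: power2_eq_square add.commute)
    qed
  qed
  show ?case
    using closed_form_step2[OF 0(2), of "{}"] A B C by (simp add: closed_form_def J)
next
  case (Suc p)
  then obtain j J' where J': "J = insert j J'" "j \<notin> J'" by (metis card_Suc_eq)
  then have fin: "finite J'" "card J' = p" using Suc by auto
  note 1 = closed_form_step1[OF _ fin(1) J'(2) Suc(1), folded J'(1)]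
  have "Suc (card J') = card J" using J' fin by simp
  then have 2: "EA K' J = scaled_coeff 0 gf.gA (card K') (card J)" "EB K' J = scaled_coeff 1 gf.gB (card K') (card J)"
    "EC K' J = scaled_coeff 1 gf.gC (card K') (card J)" if "finite K'" for K'
    using that 1[of K'] fin by auto
  have 3: "closed_form K' (J - {b})" if "finite K'" "b \<in> J" for K' b
    using that Suc by (intro Suc(1)) auto
  show ?case
    using 2[OF Suc(3)] closed_form_step2[OF Suc(3,4) 2(1,2) 3] by (simp add: closed_form_def)
qed

section \<open>Translation to \<open>f4\<close> and \<open>F4\<close>\<close>

lemma set_det_image:
  assumes "finite J" "inj h"
  shows "set_det (h ` J) A = set_det J (\<lambda>i j. A (h i) (h j))"
  using assms(1)
proof (induction J arbitrary: A)
  case empty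
  then show ?case by simp
next
  case (insert a J)
  have "h a \<notin> h ` J" using insert assms(2) by (auto dest: injD)
  then show ?case
    using insert assms(2)
    by (simp add: set_det_insert sum.reindex inj_on_subset[OF assms(2)] inj_eq if_distrib[of h] cong: if_cong)
qed

lemma f4_EA: "f4 M X n p = EA {..<n} {..<p}"
proof -
  have "Determinant.det (transpose_mat (random_mat X n p \<omega>) * random_mat X n p \<omega>)
      = gram {..<n} (cols {..<p}) (V \<omega>) (V \<omega>)" for \<omega>
  proof -
    let ?A = "transpose_mat (random_mat X n p \<omega>) * random_mat X n p \<omega>"
    have A: "?A \<in> carrier_mat p p" by (intro mult_carrier_mat[of _ p n]) (simp_all add: random_mat_def)
    have "Determinant.det ?A = set_det {..<p} (\<lambda>i j. ?A $$ (i, j))"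
      unfolding det_def'[OF A] set_det_def by (simp add: atLeast0LessThan)
    also have "\<dots> = set_det {..<p} (\<lambda>i j. inner_on {..<n} (V \<omega> (Some i)) (V \<omega> (Some j)))"
      by (intro set_det_cong) (simp add: random_mat_def scalar_prod_def inner_on_def atLeast0LessThan)
    also have "\<dots> = gram {..<n} (cols {..<p}) (V \<omega>) (V \<omega>)"
      by (simp add: gram_def set_det_image)
    finally show ?thesis .
  qed
  then show ?thesis by (simp add: f4_def EA_def power2_eq_square)
qed

text \<open>The weight in \<open>F4\<close> is the inverse of the factor in
  \<open>scaled_coeff\<close> at \<open>s = 0\<close>.\<close>

lemma F4_nth: "fps_nth (F4 M X) q = gf.gA q"
proof (rule fps_ext)
  fix p
  have "f4 M X (p + q) p = fact (p + q) * fact p / fact q * fps_nth (gf.gA q) p"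
    using closed_form[of "{..<p + q}" "{..<p}"] scaled_coeff_eval[of "p + q" p q 0 gf.gA]
    by (simp add: f4_EA closed_form_def)
  then show "fps_nth (fps_nth (F4 M X) q) p = fps_nth (gf.gA q) p"
    by (simp add: F4_def)
qed

end

section \<open>Summation over the powers of \<omega>\<close>

lemma sum_fps_const: "(\<Sum>k\<in>A. fps_const (f k)) = fps_const (\<Sum>k\<in>A. f k)"
  by (induction A rule: infinite_finite_induct) simp_all

text \<open>Constant terms in \<open>g * h = 1\<close> show that the one of \<open>g\<close> is
  nonzero, so division by \<open>g\<close> is exact. Quotients thus become products with explicit
  inverses.\<close>

lemma bi_divide_std_basis:
  fixes f g h :: bifps
  assumes "g * h = 1"
  shows "f / g = f * h"
proof -
  have "fps_nth (fps_nth g 0) 0 * fps_nth (fps_nth h 0) 0 = 1"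
    using arg_cong[OF assms, of "\<lambda>x. fps_nth (fps_nth x 0) 0"] by (simp add: fps_mult_nth)
  then have "fps_nth (fps_nth g 0) 0 \<noteq> 0" by auto
  then have "f / g * g = f" by (rule bi_divide_mult_cancel)
  then show ?thesis using assms by (metis mult.assoc mult.right_neutral)
qed

text \<open>Sums \<open>gA_closed\<close> over \<open>q\<close> by means of a geometric series and
  its analogues weighted by \<open>q\<close> and \<open>q (q - 1)\<close>.\<close>

lemma (in gf_params) bi_closed_form:
  "Abs_fps gA = bi_exp_t \<kappa>
      / ((1 - bi_const (b ^ 2) * bi_t) ^ 4 * (1 - bi_omega - bi_const (b ^ 2) * bi_t))
    * (1 + (\<Sum>k = 1..6. bi_const (p_coeff a b c k) * bi_t ^ k)
         + bi_omega * bi_const (a ^ 2) / (1 - bi_omega - bi_const (b ^ 2) * bi_t)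
           * (\<Sum>k = 1..4. bi_const (pt_coeff a b c k) * bi_t ^ k)
         + 2 * bi_omega ^ 2 * bi_const (a ^ 4 * b ^ 2) * bi_t ^ 2
           / (1 - bi_omega - bi_const (b ^ 2) * bi_t) ^ 2)"
proof -
  define D u where "D = 1 - Cb\<^sup>2 * T" and "u = inverse D"
  have uD: "u * D = 1" using u_inverse by (simp add: u_def D_def)
  have uD': "u ^ Suc n * D = u ^ n" for n using uD by (simp add: power_Suc2 mult.assoc del: power_Suc)
  \<comment> \<open>With \<open>y = D - \<omega>\<close> these are \<open>1 / y\<close>,
    \<open>\<omega> / y^2\<close> and \<open>2 \<omega>^2 / y^3\<close>; each is found by
    multiplying by \<open>y\<close> and comparing coefficients.\<close>
  define I N1 N2 where "I = Abs_fps (\<lambda>q. u ^ Suc q)" and "N1 = Abs_fps (\<lambda>q. of_nat q * u ^ Suc q)"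
    and "N2 = Abs_fps (\<lambda>q. of_nat (q * (q - 1)) * u ^ Suc q)"
  define y :: bifps where "y = fps_const D - fps_X"
  have y: "1 - bi_omega - bi_const (b ^ 2) * bi_t = y"
    by (simp add: y_def D_def bi_omega_def bi_const_def bi_t_def Cb_def algebra_simps
        fps_const_sub[symmetric] del: fps_const_sub)
  have D: "1 - bi_const (b ^ 2) * bi_t = fps_const D"
    by (simp add: D_def bi_const_def bi_t_def Cb_def fps_const_sub[symmetric] del: fps_const_sub)
  have nth_y: "fps_nth (f * y) n = fps_nth f n * D - (if n = 0 then 0 else fps_nth f (n - 1))" for f n
    by (simp add: y_def right_diff_distrib)
  have I: "I * y = 1"
    by (rule fps_ext) (auto simp: nth_y I_def uD' uD gr0_conv_Suc simp del: power_Suc)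
  have uD'': "x * u ^ Suc n * D = x * u ^ n" for x n by (simp only: mult.assoc uD')
  have N1: "N1 * y = fps_X * I"
  proof (rule fps_ext)
    fix n show "fps_nth (N1 * y) n = fps_nth (fps_X * I) n"
      by (cases n) (simp_all add: nth_y N1_def I_def uD' uD'' distrib_right del: power_Suc)
  qed
  have N2: "N2 * y = fps_X * (N1 + N1)"
  proof (rule fps_ext)
    fix n show "fps_nth (N2 * y) n = fps_nth (fps_X * (N1 + N1)) n"
    proof (cases n)
      case (Suc k)
      \<comment> \<open>Recursion \<open>(k + 1) k = k (k - 1) + 2 k\<close> of the weights; the
        last two terms come from \<open>N1 + N1\<close>.\<close>
      have "of_nat (Suc k * k) = of_nat (k * (k - 1)) + of_nat k + (of_nat k :: real fps)"
        by (cases k) (simp_all add: algebra_simps)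
      then show ?thesis
        by (simp add: Suc nth_y N2_def N1_def uD'' distrib_right del: power_Suc of_nat_mult of_nat_Suc mult_Suc)
    qed (simp add: nth_y N2_def)
  qed
  have N1': "N1 = fps_X * I * I"
    using N1 I by (metis mult.assoc mult.commute mult.right_neutral)
  have N2': "N2 = 2 * fps_X\<^sup>2 * I * I * I"
  proof -
    have "N2 = N2 * y * I" using I by (simp add: mult.assoc mult.commute[of y])
    then show ?thesis by (simp add: N2 N1' power2_eq_square mult_ac)
  qed
  define S1 S2 where "S1 = (\<Sum>k = 1..6. fps_const (p_coeff a b c k) * T ^ k)"
    and "S2 = (\<Sum>k = 1..4. fps_const (pt_coeff a b c k) * T ^ k)"
  have S: "(\<Sum>k = 1..6. bi_const (p_coeff a b c k) * bi_t ^ k) = fps_const S1"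
    "(\<Sum>k = 1..4. bi_const (pt_coeff a b c k) * bi_t ^ k) = fps_const S2"
    by (simp_all only: S1_def S2_def bi_const_def bi_t_def fps_const_power fps_const_mult sum_fps_const)
  have yI: "y * I = 1" "y\<^sup>2 * I\<^sup>2 = 1"
    using I by (simp_all add: mult.commute power_mult_distrib[symmetric])
  have "(fps_const D ^ 4 * y) * (fps_const (u ^ 4) * I) = 1"
    using yI uD by (simp add: mult_ac power_mult_distrib[symmetric])
  note div = bi_divide_std_basis[OF this] bi_divide_std_basis[OF yI(1)] bi_divide_std_basis[OF yI(2)]
  have "Abs_fps gA = fps_const (fps_exp \<kappa> * u ^ 4) * (fps_const (1 + S1) * I + fps_const (Ca\<^sup>2 * S2) * N1
      + fps_const (Ca ^ 4 * Cb\<^sup>2 * T\<^sup>2) * N2)"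
  proof (rule fps_ext)
    fix q
    \<comment> \<open>Of the \<open>q + 5\<close> factors \<open>u\<close>, four are independent of
      \<open>q\<close> and \<open>Suc q\<close> feed the geometric series.\<close>
    have "exp_u (q + 5) = fps_exp \<kappa> * u ^ 4 * u ^ Suc q"
      by (simp add: exp_u_def u_def D_def power_add eval_nat_numeral mult_ac)
    then have "gA q = fps_exp \<kappa> * u ^ 4 * u ^ Suc q * (1 + S1 + of_nat q * (Ca\<^sup>2 * S2)
        + of_nat (q * (q - 1)) * (Ca ^ 4 * Cb\<^sup>2 * T\<^sup>2))"
      unfolding gA_closed S1_def S2_def by (simp only:)
    then show "fps_nth (Abs_fps gA) q = fps_nth (fps_const (fps_exp \<kappa> * u ^ 4) * (fps_const (1 + S1) * I
        + fps_const (Ca\<^sup>2 * S2) * N1 + fps_const (Ca ^ 4 * Cb\<^sup>2 * T\<^sup>2) * N2)) q"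
      by (simp add: I_def N1_def N2_def distrib_left mult_ac del: power_Suc of_nat_mult)
  qed
  also have "\<dots> = bi_exp_t \<kappa> * (fps_const (u ^ 4) * I)
    * (1 + fps_const S1 + bi_omega * bi_const (a ^ 2) * I * fps_const S2
         + 2 * bi_omega ^ 2 * bi_const (a ^ 4 * b ^ 2) * bi_t ^ 2 * I\<^sup>2)"
  proof -
    have c: "bi_const (a ^ 2) = fps_const (Ca\<^sup>2)" "bi_const (a ^ 4 * b ^ 2) * bi_t ^ 2 = fps_const (Ca ^ 4 * Cb\<^sup>2 * T\<^sup>2)"
      by (simp_all add: bi_const_def Ca_def Cb_def bi_t_def)
    show ?thesis
      unfolding N1' N2' mult.assoc[of _ "bi_const (a ^ 4 * b ^ 2)"] c
      by (simp add: bi_exp_t_def bi_omega_def power2_eq_square algebra_simps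
          fps_const_add[symmetric] fps_const_mult[symmetric] del: fps_const_add fps_const_mult)
  qed
  finally show ?thesis unfolding D y S div .
qed

theorem theorem2:
  fixes M :: "'a measure"
    and X :: "nat \<Rightarrow> nat \<Rightarrow> 'a \<Rightarrow> real"
    and m :: "nat \<Rightarrow> real"
    and \<mu>2 \<mu>3 \<mu>4 :: real
  assumes "prob_space M"
    and "prob_space.indep_vars M (\<lambda>_. borel) (\<lambda>(i, j). X i j) UNIV"
    and "\<And>i j i' j'. distr M borel (X i j) = distr M borel (X i' j')"
    and "\<And>i j r. r \<le> 4 \<Longrightarrow> integrable M (\<lambda>x. X i j x ^ r)"
    and "\<And>i j r. r \<le> 4 \<Longrightarrow> m r = (\<integral>x. X i j x ^ r \<partial>M)"
    and "\<mu>2 = m 2 - m 1 ^ 2"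
    and "\<mu>3 = m 3 - 3 * m 1 * m 2 + 2 * m 1 ^ 3"
    and "\<mu>4 = m 4 - 4 * m 1 * m 3 + 6 * m 1 ^ 2 * m 2 - 3 * m 1 ^ 4"
  shows "F4 M X =
    bi_exp_t (\<mu>4 - 3 * \<mu>2 ^ 2)
      / ((1 - bi_const (\<mu>2 ^ 2) * bi_t) ^ 4 * (1 - bi_omega - bi_const (\<mu>2 ^ 2) * bi_t))
    * (1 + (\<Sum>k = 1..6. bi_const (p_coeff (m 1) \<mu>2 \<mu>3 k) * bi_t ^ k)
         + bi_omega * bi_const (m 1 ^ 2) / (1 - bi_omega - bi_const (\<mu>2 ^ 2) * bi_t)
           * (\<Sum>k = 1..4. bi_const (pt_coeff (m 1) \<mu>2 \<mu>3 k) * bi_t ^ k)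
         + 2 * bi_omega ^ 2 * bi_const (m 1 ^ 4 * \<mu>2 ^ 2) * bi_t ^ 2
           / (1 - bi_omega - bi_const (\<mu>2 ^ 2) * bi_t) ^ 2)"
proof -
  interpret prob_space M by fact
  interpret iid_array M X m
    using assms by unfold_locales auto
  interpret gf_params "m 1" cum2 cum3 cum4 .
  have "F4 M X = Abs_fps gA"
    by (rule fps_ext) (simp add: F4_nth del: One_nat_def)
  moreover have "\<mu>2 = cum2" "\<mu>3 = cum3" "\<mu>4 - 3 * \<mu>2 ^ 2 = cum4"
    using assms by (simp_all add: cum2_def cum3_def cum4_def)
  ultimately show ?thesis
    using bi_closed_form by simp
qed

end
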